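(* Let $p\ge 1$, let $g_2,\dots,g_{2p}$ be real with $g_{2p}>0$, let $V(\lambda)=\sum_{j=1}^{p}g_{2j}\lambda^{j}$ and $V_\lambda=dV/d\lambda$, and let $$W(r)=\sum_{k=1}^{p}\binom{2k}{k}k\,g_{2k}\,r^{k}.$$ Let $m\ge 2$ and let $r_{\mathrm c}>0$ satisfy $W'(r_{\mathrm c})=\cdots=W^{(m-1)}(r_{\mathrm c})=0$ and $W^{(m)}(r_{\mathrm c})\neq 0$; put $T_{\mathrm c}=W(r_{\mathrm c})$ and $c_m=\dfrac{W^{(m)}(r_{\mathrm c})}{2^m(2m-1)!!}$. Let $I\subset\mathbb{R}$ be an open interval and let $$r(\bar\epsilon,x)=r_{\mathrm c}+\sum_{k\ge 1}\mathfrak r_k(x)\bar\epsilon^{2k},\qquad U(\lambda,\bar\epsilon;x)=\sum_{k\ge 0}U^{[k]}(\lambda,x)\bar\epsilon^{2k}$$ be formal power series in $\bar\epsilon$, where the $\mathfrak r_k$ are $C^\infty$ on $I$, each $U^{[k]}$ is analytic in $\lambda$ for $|\lambda|>4r_{\mathrm c}$ and $C^\infty$ in $x\in I$, and $U^{[0]}=\sqrt{\lambda/(\lambda-4r_{\mathrm c})}$ (the branch tending to $1$ as $\lambda\to\infty$). Assume that, as formal power series in $\bar\epsilon$, $$r(\bar\epsilon,x)\,\big(U(\lambda,\bar\epsilon;x)+U(\lambda,\bar\epsilon;x-\bar\epsilon)\big)\big(U(\lambda,\bar\epsilon;x)+U(\lambda,\bar\epsilon;x+\bar\epsilon)\big)=\lambda\big(U(\lambda,\bar\epsilon;x)^2-1\big)$$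 and $$\oint_{|\lambda|=R}\frac{d\lambda}{2\pi i}\,V_\lambda(\lambda)\,U(\lambda,\bar\epsilon;x)=T_{\mathrm c}+\bar\epsilon^{2m}x$$ for all $x\in I$ (with $R>4r_{\mathrm c}$, circle positively oriented). Then $u=\mathfrak r_1$ satisfies on $I$ the ordinary differential equation $$c_m\,R_m(u)=x,$$ where $R_0=1$ and, for $j\ge 0$, $R_{j+1}$ is the differential polynomial in $u$ without constant term determined by $\partial_xR_{j+1}=\big(r_{\mathrm c}\partial_x^3+4u\,\partial_x+2u_x\big)R_j$.
   Context: Shifted series are understood via formal Taylor expansion: for $F(\bar\epsilon;x)=\sum_k F_k(x)\bar\epsilon^k$ and a constant $c$, $F(\bar\epsilon;x+c\bar\epsilon)=\sum_{k,n}F_k^{(n)}(x)c^n\bar\epsilon^{k+n}/n!$, and identities between formal series mean equality of the coefficient of each power of $\bar\epsilon$. The contour integral $\oint\frac{d\lambda}{2\pi i}$ over a large positively oriented circle equals the coefficient of $\lambda^{-1}$ in the expansion at $\lambda=\infty$. The equation $c_mR_m(u)=x$ is the $(m-1)$-th member of the Painlevé I hierarchy (for $m=2$: $c_2(2r_{\mathrm c}u_{xx}+6u^2)=x$). *)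

theory Defs
  imports "HOL-Complex_Analysis.Complex_Analysis" "HOL-Library.Poly_Mapping"
begin

fun dfact :: "nat \<Rightarrow> nat" where
  "dfact 0 = 1"
| "dfact (Suc 0) = 1"
| "dfact (Suc (Suc n)) = Suc (Suc n) * dfact n"

definition nderiv :: "nat \<Rightarrow> (real \<Rightarrow> 'a::real_normed_vector) \<Rightarrow> real \<Rightarrow> 'a" where
  "nderiv n f = ((\<lambda>g x. vector_derivative g (at x)) ^^ n) f"

definition smooth_on :: "real set \<Rightarrow> (real \<Rightarrow> 'a::real_normed_vector) \<Rightarrow> bool" where
  "smooth_on I f \<longleftrightarrow>
     (\<forall>n. \<forall>x\<in>I. (nderiv n f has_vector_derivative nderiv (Suc n) f x) (at x))"

definition cprod :: "(nat \<Rightarrow> 'a::comm_semiring_1) \<Rightarrow> (nat \<Rightarrow> 'a) \<Rightarrow> nat \<Rightarrow> 'a" where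
  "cprod f g N = (\<Sum>i\<le>N. f i * g (N - i))"

text \<open>Coefficients of F(eps; x + c eps) by formal Taylor expansion, where F N is the coefficient
  of eps^N: sum over k + n = N of F_k^(n)(x) c^n / n!.\<close>
definition shift_coeff :: "real \<Rightarrow> (nat \<Rightarrow> real \<Rightarrow> complex) \<Rightarrow> nat \<Rightarrow> real \<Rightarrow> complex" where
  "shift_coeff c F N x = (\<Sum>n\<le>N. complex_of_real (c ^ n / fact n) * nderiv n (F (N - n)) x)"

definition r_coeff :: "real \<Rightarrow> (nat \<Rightarrow> real \<Rightarrow> real) \<Rightarrow> nat \<Rightarrow> real \<Rightarrow> real" where
  "r_coeff rc rk N x = (if N = 0 then rc else if even N then rk (N div 2) x else 0)"

definition U_coeff :: "(nat \<Rightarrow> complex \<Rightarrow> real \<Rightarrow> complex) \<Rightarrow> nat \<Rightarrow> complex \<Rightarrow> real \<Rightarrow> complex" where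
  "U_coeff U N l x = (if even N then U (N div 2) l x else 0)"

definition Vlam :: "(nat \<Rightarrow> real) \<Rightarrow> nat \<Rightarrow> complex \<Rightarrow> complex" where
  "Vlam g p l = (\<Sum>j=1..p. of_nat j * complex_of_real (g (2*j)) * l ^ (j - 1))"

definition Wfun :: "(nat \<Rightarrow> real) \<Rightarrow> nat \<Rightarrow> real \<Rightarrow> real" where
  "Wfun g p r = (\<Sum>k=1..p. real ((2*k) choose k) * real k * g (2*k) * r ^ k)"

text \<open>A differential polynomial in u is a polynomial (with real coefficients) in the
  variables u_0 = u, u_1 = u_x, u_2 = u_xx, ...; monomials are finitely supported
  exponent vectors nat =>0 nat.\<close>
type_synonym dpoly = "(nat \<Rightarrow>\<^sub>0 nat) \<Rightarrow>\<^sub>0 real"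

definition dvar :: "nat \<Rightarrow> dpoly" where
  "dvar i = Poly_Mapping.single (Poly_Mapping.single i 1) 1"

definition dconst :: "real \<Rightarrow> dpoly" where
  "dconst c = Poly_Mapping.single 0 c"

text \<open>Total x-derivative: the derivation with u_i |-> u_(i+1).\<close>
definition dD :: "dpoly \<Rightarrow> dpoly" where
  "dD P = (\<Sum>a::nat \<Rightarrow>\<^sub>0 nat\<in>Poly_Mapping.keys P. \<Sum>i::nat\<in>Poly_Mapping.keys a.
      Poly_Mapping.single (a - Poly_Mapping.single i 1 + Poly_Mapping.single (Suc i) 1)
                          (Poly_Mapping.lookup P a * of_nat (Poly_Mapping.lookup a i) :: real))"

definition deval :: "dpoly \<Rightarrow> (nat \<Rightarrow> real) \<Rightarrow> real" where
  "deval P J = (\<Sum>a::nat \<Rightarrow>\<^sub>0 nat\<in>Poly_Mapping.keys P. Poly_Mapping.lookup P a * (\<Prod>i\<in>Poly_Mapping.keys a. J i ^ Poly_Mapping.lookup a i))"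

fun Rpoly :: "real \<Rightarrow> nat \<Rightarrow> dpoly" where
  "Rpoly rc 0 = 1"
| "Rpoly rc (Suc j) =
     (THE P. dD P = dconst rc * dD (dD (dD (Rpoly rc j))) + dconst 4 * dvar 0 * dD (Rpoly rc j)
                     + dconst 2 * dvar 1 * Rpoly rc j
            \<and> Poly_Mapping.lookup P 0 = 0)"

end

theory Submission
  imports Defs
begin

text \<open>
  Fix \<open>x\<^sub>0 \<in> I\<close> and replace functions of \<open>x\<close> by their Taylor jets at \<open>x\<^sub>0\<close>, which form a
  differential ring.  With \<open>s = 1 / (\<lambda> - 4 r\<^sub>c)\<close> and \<open>\<phi> = U\<^bsup>[0]\<^esup>\<close> one has \<open>\<phi>\<^sup>2 = \<lambda> s\<close>, and \<open>Q = U / \<phi>\<close>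
  satisfies \<open>s r (Q + Q\<^sup>-) (Q + Q\<^sup>+) = (1 + 4 r\<^sub>c s) Q\<^sup>2 - 1\<close>, which can be rewritten as
  \<open>Q\<^sup>2 = 1 + \<epsilon>\<^sup>2 s \<Theta>(Q)\<close>.  This has exactly one formal solution with constant term \<open>1\<close>; the
  coefficient of \<open>\<epsilon>\<^bsup>2k\<^esup>\<close> is a polynomial of degree at most \<open>k\<close> in \<open>s\<close>, and vanishes at \<open>s = 0\<close> if \<open>k > 0\<close>.
  The coefficients \<open>A\<^sub>k\<close> of \<open>s\<^sup>k \<epsilon>\<^bsup>2k\<^esup>\<close> satisfy the Gelfand-Dickey equation
  \<open>A\<^sup>2 - 1 = \<sigma> (4 u A\<^sup>2 + r\<^sub>c (2 A A'' - A'\<^sup>2))\<close> for \<open>A = \<Sum> A\<^sub>k \<sigma>\<^sup>k\<close>; differentiating it and cancelling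
  \<open>2 A\<close> gives the recursion of the \<open>R\<^sub>k\<close>, so \<open>A\<^sub>k = R\<^sub>k(u)\<close>.  The same equation, solved over differential
  polynomials, shows that the recursion can be integrated within differential polynomials.
  Finally \<open>\<phi> s\<^sup>j\<close> is \<open>1 / (2\<^sup>j (2j - 1)!!)\<close> times the \<open>j\<close>-th derivative of \<open>(1 - 4 r / \<lambda>)\<^bsup>-1/2\<^esup>\<close> in \<open>r\<close>, so the
  contour integral of \<open>V\<^sub>\<lambda> \<phi> s\<^sup>j\<close> is \<open>W\<^bsup>(j)\<^esup>(r\<^sub>c) / (2\<^sup>j (2j - 1)!!)\<close>.  At order \<open>\<epsilon>\<^bsup>2m\<^esup>\<close> criticality leaves
  only \<open>j = m\<close>.
\<close>

unbundle no vec_syntax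

section \<open>Square root equations for formal power series over a differential ring\<close>

lemma fps_X_power_dvd_iff:
  fixes F :: "'a::comm_ring_1 fps"
  shows "fps_X ^ n dvd F \<longleftrightarrow> (\<forall>i<n. F $ i = 0)"
proof
  assume "fps_X ^ n dvd F"
  then obtain H where "F = fps_X ^ n * H" by (auto simp: dvd_def)
  then show "\<forall>i<n. F $ i = 0" by (simp add: fps_X_power_mult_nth)
next
  assume "\<forall>i<n. F $ i = 0"
  then have "F = fps_X ^ n * fps_shift n F"
    by (intro fps_ext) (auto simp: fps_X_power_mult_nth)
  then show "fps_X ^ n dvd F" by (metis dvd_triv_left)
qed

lemma fps_eqI_X_power_dvd:
  fixes F G :: "'a::comm_ring_1 fps"
  assumes "\<And>n. fps_X ^ n dvd F - G"
  shows "F = G"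
proof (rule fps_ext)
  fix n show "F $ n = G $ n"
    using assms[of "Suc n"] unfolding fps_X_power_dvd_iff by simp
qed

lemma dvd_mult_diff:
  fixes a b c d x :: "'a::comm_ring_1"
  assumes "x dvd a - b" "x dvd c - d"
  shows "x dvd a * c - b * d"
proof -
  have "a * c - b * d = (a - b) * c + b * (c - d)" by (simp add: algebra_simps)
  then show ?thesis using assms by (metis dvd_add dvd_mult dvd_mult2)
qed

text \<open>Newton's step for F^2 = 1 + X T(F), with the derivative of the square frozen at its
  value 2 at F = 1; \<open>h\<close> stands for one half.\<close>

definition sqrt_step :: "'a::comm_ring_1 \<Rightarrow> ('a fps \<Rightarrow> 'a fps) \<Rightarrow> 'a fps \<Rightarrow> 'a fps" where
  "sqrt_step h T F = F + fps_const h * (1 + fps_X * T F - F\<^sup>2)"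

lemma sqrt_step_nth_0:
  assumes "F $ 0 = 1"
  shows "sqrt_step h T F $ 0 = 1"
  using assms by (simp add: sqrt_step_def power2_eq_square)

lemma sqrt_step_fixed_iff:
  assumes "2 * h = 1"
  shows "sqrt_step h T F = F \<longleftrightarrow> F\<^sup>2 = 1 + fps_X * T F"
proof -
  have c: "(fps_const h * H = 0) \<longleftrightarrow> H = 0" for H :: "'a fps"
  proof
    assume "fps_const h * H = 0"
    moreover have "H = 2 * (fps_const h * H)"
    proof (rule fps_ext)
      fix n
      have "(2 * (fps_const h * H)) $ n = (2 * h) * H $ n"
        by (simp only: mult_2 fps_add_nth fps_mult_left_const_nth distrib_right)
      then show "H $ n = (2 * (fps_const h * H)) $ n" by (simp only: assms mult_1)
    qed
    ultimately show "H = 0" by (metis mult_zero_right)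
  qed simp
  show ?thesis using c[of "1 + fps_X * T F - F\<^sup>2"] by (auto simp: sqrt_step_def)
qed

text \<open>The difference of two steps is (F - G)(1 - h(F + G)) + h X (T F - T G). As both constant
  terms are 1 and 2h = 1, the second bracket has constant term 0, so each summand gains a factor
  X.\<close>

lemma sqrt_step_contraction:
  assumes h: "2 * h = (1 :: 'a::comm_ring_1)"
    and T: "\<And>n F G. fps_X ^ n dvd F - G \<Longrightarrow> fps_X ^ n dvd T F - T G"
    and F: "F $ 0 = 1" and G: "G $ 0 = 1" and d: "fps_X ^ n dvd F - G"
  shows "fps_X ^ Suc n dvd sqrt_step h T F - sqrt_step h T G"
proof -
  have e: "sqrt_step h T F - sqrt_step h T G
      = (F - G) * (1 - fps_const h * (F + G)) + fps_const h * (fps_X * (T F - T G))"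
    unfolding sqrt_step_def by (simp add: algebra_simps power2_eq_square)
  have "(1 - fps_const h * (F + G)) $ 0 = 0" using h F G by (simp add: mult.commute)
  then have "fps_X dvd 1 - fps_const h * (F + G)"
    using fps_X_power_dvd_iff[of 1 "1 - fps_const h * (F + G)"] by simp
  from mult_dvd_mono[OF d this] have 1: "fps_X ^ Suc n dvd (F - G) * (1 - fps_const h * (F + G))"
    by (simp add: mult.commute)
  have "fps_X ^ Suc n dvd fps_X * (T F - T G)"
    using mult_dvd_mono[OF dvd_refl T[OF d], of fps_X] by simp
  then have "fps_X ^ Suc n dvd fps_const h * (fps_X * (T F - T G))" by (rule dvd_mult)
  with 1 show ?thesis unfolding e by (rule dvd_add)
qed

lemma sqrt_eq_unique:
  fixes T :: "'a::comm_ring_1 fps \<Rightarrow> 'a fps"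
  assumes h: "2 * h = (1 :: 'a)"
    and T: "\<And>n F G. fps_X ^ n dvd F - G \<Longrightarrow> fps_X ^ n dvd T F - T G"
    and F: "F $ 0 = 1" "F\<^sup>2 = 1 + fps_X * T F" and G: "G $ 0 = 1" "G\<^sup>2 = 1 + fps_X * T G"
  shows "F = G"
proof (rule fps_eqI_X_power_dvd)
  fix n show "fps_X ^ n dvd F - G"
  proof (induction n)
    case (Suc n)
    from sqrt_step_contraction[where T = T, OF h T F(1) G(1) Suc]
    show ?case
      using sqrt_step_fixed_iff[OF h, of T F] F(2)
        sqrt_step_fixed_iff[OF h, of T G] G(2) by simp
  qed simp
qed

text \<open>The iterates of the step starting at 1 converge X-adically. The set \<open>S\<close>
  passes an invariant of the step on to the limit, one coefficient at a time; the weight bound below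
  is obtained in this way.\<close>

lemma sqrt_eq_exists:
  fixes T :: "'a::comm_ring_1 fps \<Rightarrow> 'a fps"
  assumes h: "2 * h = (1 :: 'a)"
    and T: "\<And>n F G. fps_X ^ n dvd F - G \<Longrightarrow> fps_X ^ n dvd T F - T G"
    and S: "1 \<in> S" "\<And>F. F \<in> S \<Longrightarrow> sqrt_step h T F \<in> S"
  shows "\<exists>F. F $ 0 = 1 \<and> F\<^sup>2 = 1 + fps_X * T F \<and> (\<forall>n. \<exists>G\<in>S. F $ n = G $ n)"
proof -
  define it where "it n = (sqrt_step h T ^^ n) 1" for n
  have it0: "it n $ 0 = 1" for n
    by (induction n) (auto simp: it_def sqrt_step_nth_0)
  have itS: "it n \<in> S" for n
    by (induction n) (auto simp: it_def S)
  have it_Suc: "it (Suc n) = sqrt_step h T (it n)" for n by (simp add: it_def)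
  have step: "fps_X ^ n dvd it (Suc n) - it n" for n
  proof (induction n)
    case (Suc n)
    show ?case using sqrt_step_contraction[OF h T it0 it0 Suc] by (simp add: it_Suc)
  qed simp
  have far: "fps_X ^ n dvd it (n + k) - it n" for n k
  proof (induction k)
    case (Suc k)
    have "fps_X ^ n dvd it (Suc (n + k)) - it (n + k)"
      using step[of "n + k"] by (meson dvd_trans le_add1 le_imp_power_dvd)
    from dvd_add[OF this Suc] show ?case by simp
  qed simp
  \<comment> \<open>By \<open>step\<close>, coefficient n is settled from iterate n + 1 on, hence
    the \<open>Suc\<close>.\<close>
  define L where "L = Abs_fps (\<lambda>n. it (Suc n) $ n)"
  have L0: "L $ 0 = 1" by (simp add: L_def it0)
  have L: "fps_X ^ n dvd L - it n" for n
    unfolding fps_X_power_dvd_iff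
  proof (intro allI impI)
    fix i assume "i < n"
    then obtain k where "n = Suc i + k" by (metis less_iff_Suc_add add_Suc)
    with far[of "Suc i" k] show "(L - it n) $ i = 0"
      unfolding fps_X_power_dvd_iff by (auto simp: L_def)
  qed
  have "sqrt_step h T L = L"
  proof (rule fps_eqI_X_power_dvd)
    fix n
    have "fps_X ^ Suc n dvd sqrt_step h T L - it (Suc n)"
      unfolding it_Suc by (rule sqrt_step_contraction[OF h T L0 it0 L])
    from dvd_diff[OF this L[of "Suc n"]]
    have "fps_X ^ Suc n dvd sqrt_step h T L - L" by simp
    then show "fps_X ^ n dvd sqrt_step h T L - L" by (meson dvd_trans le_imp_power_dvd lessI less_imp_le)
  qed
  then have "L\<^sup>2 = 1 + fps_X * T L" by (simp add: sqrt_step_fixed_iff[OF h])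
  moreover have "\<forall>n. \<exists>G\<in>S. L $ n = G $ n"
    using itS by (auto simp: L_def)
  ultimately show ?thesis using L0 by blast
qed

text \<open>One calculus serves Taylor jets, differential polynomials, polynomials in s, and power
  series over any of them. The map \<open>\<kappa>\<close> provides the constants of Taylor's
  formula and one half.\<close>

locale diff_ring =
  fixes D :: "'a::comm_ring_1 \<Rightarrow> 'a" and \<kappa> :: "real \<Rightarrow> 'a"
  assumes D_add: "D (a + b) = D a + D b"
    and D_mult: "D (a * b) = D a * b + a * D b"
    and D_const: "D (\<kappa> c) = 0"
    and const_add: "\<kappa> (c + d) = \<kappa> c + \<kappa> d"
    and const_mult: "\<kappa> (c * d) = \<kappa> c * \<kappa> d"
    and const_1: "\<kappa> 1 = 1"
begin


lemma D_0 [simp]: "D 0 = 0"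
  using D_add[of 0 0] by simp

lemma D_1 [simp]: "D 1 = 0"
  using D_const[of 1] by (simp add: const_1)

lemma D_minus: "D (- a) = - D a"
  using D_add[of a "- a"] by (simp add: eq_neg_iff_add_eq_0 add.commute)

lemma D_diff: "D (a - b) = D a - D b"
  using D_add[of a "- b"] by (simp add: D_minus)

lemma D_sum: "D (sum f S) = (\<Sum>i\<in>S. D (f i))"
  by (induction S rule: infinite_finite_induct) (auto simp: D_add)

lemma D_const_mult: "D (\<kappa> c * a) = \<kappa> c * D a"
  by (simp add: D_mult D_const)

lemma const_0 [simp]: "\<kappa> 0 = 0"
  using const_add[of 0 0] by simp

lemma const_minus: "\<kappa> (- c) = - \<kappa> c"
  using const_add[of c "- c"] by (simp add: eq_neg_iff_add_eq_0 add.commute)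

lemma const_of_nat: "\<kappa> (of_nat n) = of_nat n"
  by (induction n) (auto simp: const_add const_1)

lemma const_numeral: "\<kappa> (numeral n) = numeral n"
  using const_of_nat[of "numeral n"] by simp

lemma two_const_half: "2 * \<kappa> (1 / 2) = 1"
  using const_mult[of 2 "1/2"] by (simp add: const_1 const_numeral)

lemma funpow_D_0 [simp]: "(D ^^ n) 0 = 0"
  by (induction n) auto

lemma funpow_D_diff: "(D ^^ n) (a - b) = (D ^^ n) a - (D ^^ n) b"
  by (induction n) (auto simp: D_diff)

lemma D_power: "D (a ^ n) = of_nat n * a ^ (n - 1) * D a"
proof (induction n)
  case (Suc n)
  then show ?case
    by (cases n) (auto simp: D_mult algebra_simps)
qed simp

definition Dh :: "'a fps \<Rightarrow> 'a fps" where
  "Dh F = Abs_fps (\<lambda>n. D (F $ n))"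

text \<open>This is the sum of c_n X^n D^n; with X as epsilon and c_n = c^n / n! it is Taylor's
  formula for the shift by c epsilon.\<close>

definition Op :: "(nat \<Rightarrow> real) \<Rightarrow> 'a fps \<Rightarrow> 'a fps" where
  "Op c F = Abs_fps (\<lambda>N. \<Sum>n\<le>N. \<kappa> (c n) * (D ^^ n) (F $ (N - n)))"

lemma Dh_nth [simp]: "Dh F $ n = D (F $ n)"
  by (simp add: Dh_def)

lemma Op_nth: "Op c F $ N = (\<Sum>n\<le>N. \<kappa> (c n) * (D ^^ n) (F $ (N - n)))"
  by (simp add: Op_def)

lemma diff_ring_fps: "diff_ring Dh (\<lambda>c. fps_const (\<kappa> c))"
proof
  show "Dh (F * G) = Dh F * G + F * Dh G" for F G
    by (intro fps_ext) (simp add: fps_mult_nth D_sum D_mult sum.distrib)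
qed (auto intro!: fps_ext simp: D_add D_const const_add const_mult const_1
       fps_const_add[symmetric] simp del: fps_const_add)

lemma Dh_X_mult: "Dh (fps_X * F) = fps_X * Dh F"
  by (intro fps_ext) simp

lemma Dh_X [simp]: "Dh fps_X = 0"
  by (intro fps_ext) simp

lemma Dh_X_power_mult: "Dh (fps_X ^ n * F) = fps_X ^ n * Dh F"
  by (intro fps_ext) (simp add: fps_X_power_mult_nth)

lemma Op_X_mult: "Op c (fps_X * F) = fps_X * Op c F"
proof (intro fps_ext)
  fix N show "Op c (fps_X * F) $ N = (fps_X * Op c F) $ N"
  proof (cases N)
    case (Suc M)
    then show ?thesis by (auto simp: Op_nth Suc_diff_le intro!: sum.cong)
  qed (simp add: Op_nth)
qed

lemma Op_X_power_mult: "Op c (fps_X ^ n * F) = fps_X ^ n * Op c F"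
  by (induction n) (auto simp: Op_X_mult mult.assoc)

lemma Op_diff: "Op c (F - G) = Op c F - Op c G"
  by (intro fps_ext) (simp add: Op_nth funpow_D_diff algebra_simps sum_subtractf)

lemma Dh_causal:
  assumes "fps_X ^ n dvd F - G"
  shows "fps_X ^ n dvd Dh F - Dh G"
proof -
  interpret L: diff_ring Dh "\<lambda>c. fps_const (\<kappa> c)" by (rule diff_ring_fps)
  obtain H where "F - G = fps_X ^ n * H" using assms by (auto simp: dvd_def)
  then have "Dh F - Dh G = fps_X ^ n * Dh H" by (metis L.D_diff Dh_X_power_mult)
  then show ?thesis by simp
qed

lemma Op_causal:
  assumes "fps_X ^ n dvd F - G"
  shows "fps_X ^ n dvd Op c F - Op c G"
proof -
  obtain H where "F - G = fps_X ^ n * H" using assms by (auto simp: dvd_def)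
  then have "Op c F - Op c G = fps_X ^ n * Op c H" by (metis Op_diff Op_X_power_mult)
  then show ?thesis by simp
qed

text \<open>Splitting off the term n = 0 leaves an operator of the same kind, so two applications
  give a Taylor expansion with remainder of order two.\<close>

lemma Op_unfold: "Op c F = fps_const (\<kappa> (c 0)) * F + fps_X * Op (\<lambda>n. c (Suc n)) (Dh F)"
proof (intro fps_ext)
  fix N show "Op c F $ N = (fps_const (\<kappa> (c 0)) * F + fps_X * Op (\<lambda>n. c (Suc n)) (Dh F)) $ N"
  proof (cases N)
    case (Suc M)
    show ?thesis unfolding Suc
      by (simp add: Op_nth sum.atMost_Suc_shift del: sum.atMost_Suc funpow.simps)
         (simp add: funpow_swap1)
  qed (simp add: Op_nth)
qed

section \<open>The string equation and the Gelfand-Dickey equation as square root equations\<close>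

definition shift :: "real \<Rightarrow> 'a fps \<Rightarrow> 'a fps" where
  "shift c = Op (\<lambda>n. c ^ n / fact n)"

definition shift_rest :: "real \<Rightarrow> 'a fps \<Rightarrow> 'a fps" where
  "shift_rest c F = Op (\<lambda>n. c ^ (n + 2) / fact (n + 2)) (Dh (Dh F))"

lemma shift_expand:
  "shift c F = F + fps_const (\<kappa> c) * fps_X * Dh F + fps_X\<^sup>2 * shift_rest c F"
  unfolding shift_def shift_rest_def
  by (subst Op_unfold, subst Op_unfold)
     (simp add: const_1 algebra_simps power2_eq_square del: fact_Suc)

text \<open>The two factors of the string equation are 2F - X F' and 2F + X F', up to X^2 times a
  remainder. In their product the terms linear in X cancel; this is what is left beyond 4 F^2,
  divided by X^2.\<close>

definition string_rest :: "'a fps \<Rightarrow> 'a fps" where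
  "string_rest F = 2 * F * (shift_rest 1 F + shift_rest (-1) F) - (Dh F)\<^sup>2
     + fps_X * (Dh F * (shift_rest (-1) F - shift_rest 1 F))
     + fps_X\<^sup>2 * (shift_rest 1 F * shift_rest (-1) F)"

lemma shift_product:
  "(F + shift (-1) F) * (F + shift 1 F) = 4 * F\<^sup>2 + fps_X\<^sup>2 * string_rest F"
  unfolding shift_expand string_rest_def
  by (simp add: const_1 const_minus fps_const_neg[symmetric] algebra_simps power2_eq_square
        del: fps_const_neg)

text \<open>Here X is epsilon and \<open>\<rho>\<close> is (r - r_c) / epsilon^2. The term 4 r_c s
  F^2 has cancelled between the two sides of the string equation. The inner \<open>fps_X\<close>,
  together with the one in the square root equation, gives epsilon^2.\<close>

definition string_op :: "real \<Rightarrow> 'a fps \<Rightarrow> 'a \<Rightarrow> 'a fps \<Rightarrow> 'a fps" where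
  "string_op rc \<rho> s F = fps_const s * (fps_X * (4 * \<rho> * F\<^sup>2
     + (fps_const (\<kappa> rc) + fps_X\<^sup>2 * \<rho>) * string_rest F))"

text \<open>Here X is no longer epsilon but the scaling variable sigma, which replaces s
  epsilon^2.\<close>

definition gd_op :: "real \<Rightarrow> 'a \<Rightarrow> 'a fps \<Rightarrow> 'a fps" where
  "gd_op rc u F = 4 * fps_const u * F\<^sup>2 + fps_const (\<kappa> rc) * (2 * F * Dh (Dh F) - (Dh F)\<^sup>2)"

lemma string_eq_iff:
  "fps_const s * ((fps_const (\<kappa> rc) + fps_X\<^sup>2 * \<rho>) * ((F + shift (-1) F) * (F + shift 1 F)))
     = (1 + 4 * fps_const (\<kappa> rc) * fps_const s) * F\<^sup>2 - 1
   \<longleftrightarrow> F\<^sup>2 = 1 + fps_X * string_op rc \<rho> s F"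
  (is "?L = ?R \<longleftrightarrow> _")
proof -
  have "?L - ?R = 1 + fps_X * string_op rc \<rho> s F - F\<^sup>2"
    unfolding shift_product string_op_def by (simp add: algebra_simps power2_eq_square)
  then show ?thesis by (metis eq_iff_diff_eq_0)
qed

text \<open>The operator is composed of ring operations, \<open>Dh\<close> and \<open>Op\<close>,
  and none of these lowers the order to which two series agree.\<close>

lemma string_op_causal:
  assumes "fps_X ^ n dvd F - G"
  shows "fps_X ^ n dvd string_op rc \<rho> s F - string_op rc \<rho> s G"
proof -
  have C: "fps_X ^ n dvd a - a" for a :: "'a fps" by simp
  have A: "fps_X ^ n dvd (a + b) - (c + d)" if "fps_X ^ n dvd a - c" "fps_X ^ n dvd b - d"
    for a b c d :: "'a fps" using dvd_add[OF that] by (simp add: algebra_simps)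
  have B: "fps_X ^ n dvd (a - b) - (c - d)" if "fps_X ^ n dvd a - c" "fps_X ^ n dvd b - d"
    for a b c d :: "'a fps" using dvd_diff[OF that] by (simp add: algebra_simps)
  show ?thesis
    unfolding string_op_def string_rest_def shift_rest_def power2_eq_square
    by (intro A B dvd_mult_diff C assms Dh_causal Op_causal)
qed

lemma gd_op_causal:
  assumes "fps_X ^ n dvd F - G"
  shows "fps_X ^ n dvd gd_op rc u F - gd_op rc u G"
proof -
  have C: "fps_X ^ n dvd a - a" for a :: "'a fps" by simp
  have A: "fps_X ^ n dvd (a + b) - (c + d)" if "fps_X ^ n dvd a - c" "fps_X ^ n dvd b - d"
    for a b c d :: "'a fps" using dvd_add[OF that] by (simp add: algebra_simps)
  have B: "fps_X ^ n dvd (a - b) - (c - d)" if "fps_X ^ n dvd a - c" "fps_X ^ n dvd b - d"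
    for a b c d :: "'a fps" using dvd_diff[OF that] by (simp add: algebra_simps)
  show ?thesis
    unfolding gd_op_def power2_eq_square
    by (intro A B dvd_mult_diff C assms Dh_causal)
qed

text \<open>When the quadratic equation is differentiated, the products A' A'' cancel and a factor 2
  A can be taken out. What remains is a linear third order equation Y = 0, whose coefficients are
  the recursion.\<close>

lemma gd_eq_imp_lenard:
  assumes A: "A $ 0 = 1" "A\<^sup>2 = 1 + fps_X * gd_op rc u A"
  shows "D (A $ Suc j) = \<kappa> rc * D (D (D (A $ j))) + 4 * u * D (A $ j) + 2 * D u * A $ j"
proof -
  interpret L: diff_ring Dh "\<lambda>c. fps_const (\<kappa> c)" by (rule diff_ring_fps)
  define Y where "Y = Dh A - fps_X * (fps_const (\<kappa> rc) * Dh (Dh (Dh A))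
     + 4 * fps_const u * Dh A + 2 * fps_const (D u) * A)"
  have n: "Dh (numeral k) = 0" for k using L.D_const[of "numeral k"] by (simp add: L.const_numeral)
  have u: "Dh (fps_const u) = fps_const (D u)" by (intro fps_ext) simp
  have "Dh (A\<^sup>2) = Dh (1 + fps_X * gd_op rc u A)" using A(2) by simp
  then have "2 * (A * Y) = 0"
    unfolding gd_op_def Y_def
    by (simp add: L.D_add L.D_mult L.D_diff L.D_const Dh_X_mult n u power2_eq_square algebra_simps)
  then have "fps_const (\<kappa> (1/2)) * 2 * (A * Y) = 0" by (simp add: mult.assoc)
  moreover have "fps_const (\<kappa> (1/2)) * 2 = 1"
    using L.two_const_half by (simp add: mult.commute)
  ultimately have AY: "A * Y = 0" by simp
  \<comment> \<open>The ring may have zero divisors; A can be cancelled because its constant term is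
    1, so that the lowest coefficient of Y survives in A Y.\<close>
  have Y0: "Y $ n = 0" for n
  proof (induction n rule: less_induct)
    case (less n)
    have "(A * Y) $ n = A $ 0 * Y $ n + (\<Sum>i=1..n. A $ i * Y $ (n - i))"
      unfolding fps_mult_nth by (simp add: sum.atLeast_Suc_atMost)
    also have "(\<Sum>i=1..n. A $ i * Y $ (n - i)) = 0"
      by (intro sum.neutral) (auto simp: less)
    finally show ?case using AY A(1) by simp
  qed
  have "Y $ Suc j = 0" by (rule Y0)
  then show ?thesis unfolding Y_def by (simp add: mult.assoc numeral_fps_const)
qed

end

section \<open>Differential polynomials\<close>

text \<open>Such maps carry solutions of the square root equations from a universal ring to a
  concrete one: from differential polynomials to jets, and from polynomials in s to a value of
  s.\<close>

locale diff_ring_hom = A: diff_ring D \<kappa> + B: diff_ring D' \<kappa>'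
  for D :: "'a::comm_ring_1 \<Rightarrow> 'a" and \<kappa> :: "real \<Rightarrow> 'a"
    and D' :: "'b::comm_ring_1 \<Rightarrow> 'b" and \<kappa>' :: "real \<Rightarrow> 'b" +
  fixes h :: "'a \<Rightarrow> 'b"
  assumes hom_add: "h (a + b) = h a + h b"
    and hom_mult: "h (a * b) = h a * h b"
    and hom_const: "h (\<kappa> c) = \<kappa>' c"
    and hom_D: "h (D a) = D' (h a)"
begin

lemma hom_0 [simp]: "h 0 = 0"
  using hom_const[of 0] by simp

lemma hom_1 [simp]: "h 1 = 1"
  using hom_const[of 1] by (simp add: A.const_1 B.const_1)

lemma hom_minus: "h (- a) = - h a"
  using hom_add[of a "- a"] by (simp add: eq_neg_iff_add_eq_0 add.commute)

lemma hom_diff: "h (a - b) = h a - h b"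
  using hom_add[of a "- b"] by (simp add: hom_minus)

lemma hom_sum: "h (sum f S) = (\<Sum>i\<in>S. h (f i))"
  by (induction S rule: infinite_finite_induct) (auto simp: hom_add)

lemma hom_numeral: "h (numeral n) = numeral n"
  using hom_const[of "numeral n"] by (simp add: A.const_numeral B.const_numeral)

lemma hom_funpow_D: "h ((D ^^ n) a) = (D' ^^ n) (h a)"
  by (induction n) (auto simp: hom_D)

definition hf :: "'a fps \<Rightarrow> 'b fps" where
  "hf F = Abs_fps (\<lambda>n. h (F $ n))"

lemma hf_nth [simp]: "hf F $ n = h (F $ n)"
  by (simp add: hf_def)

lemma hf_add: "hf (F + G) = hf F + hf G"
  by (intro fps_ext) (simp add: hom_add)

lemma hf_diff: "hf (F - G) = hf F - hf G"
  by (intro fps_ext) (simp add: hom_diff)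

lemma hf_mult: "hf (F * G) = hf F * hf G"
  by (intro fps_ext) (simp add: fps_mult_nth hom_sum hom_mult)

lemma hf_fps_const: "hf (fps_const a) = fps_const (h a)"
  by (intro fps_ext) simp

lemma hf_1: "hf 1 = 1"
  using hf_fps_const[of 1] by simp

lemma hf_X: "hf fps_X = fps_X"
  by (intro fps_ext) (simp add: fps_X_def)

lemma hf_numeral: "hf (numeral n) = numeral n"
  using hf_fps_const[of "numeral n"] by (simp add: hom_numeral numeral_fps_const)

lemma hf_Dh: "hf (A.Dh F) = B.Dh (hf F)"
  by (intro fps_ext) (simp add: hom_D)

lemma hf_Op: "hf (A.Op c F) = B.Op c (hf F)"
  by (intro fps_ext) (simp add: A.Op_nth B.Op_nth hom_sum hom_mult hom_const hom_funpow_D)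

lemma hf_string_op:
  "hf (A.string_op rc \<rho> s F) = B.string_op rc (hf \<rho>) (h s) (hf F)"
  unfolding A.string_op_def B.string_op_def A.string_rest_def B.string_rest_def
    A.shift_rest_def B.shift_rest_def power2_eq_square
  by (simp only: hf_add hf_diff hf_mult hf_fps_const hf_X hf_numeral hf_Dh hf_Op hom_const)

lemma hf_gd_op: "hf (A.gd_op rc u F) = B.gd_op rc (h u) (hf F)"
  unfolding A.gd_op_def B.gd_op_def power2_eq_square
  by (simp only: hf_add hf_diff hf_mult hf_fps_const hf_X hf_numeral hf_Dh hom_const)

end

section \<open>The total derivative is a derivation whose kernel consists of the constants\<close>

lemma poly_mapping_sum_single:
  fixes P :: "'a \<Rightarrow>\<^sub>0 'b::comm_monoid_add"
  shows "(\<Sum>a\<in>Poly_Mapping.keys P. Poly_Mapping.single a (Poly_Mapping.lookup P a)) = P"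
proof (rule poly_mapping_eqI)
  fix k
  have "(\<Sum>a\<in>Poly_Mapping.keys P. Poly_Mapping.lookup P a when a = k) = Poly_Mapping.lookup P k"
    by (simp add: when_def in_keys_iff)
  then show "Poly_Mapping.lookup (\<Sum>a\<in>Poly_Mapping.keys P.
      Poly_Mapping.single a (Poly_Mapping.lookup P a)) k = Poly_Mapping.lookup P k"
    by (simp add: lookup_sum lookup_single)
qed

lemma poly_mapping_single_add_induct [case_names single add]:
  fixes P :: "'a \<Rightarrow>\<^sub>0 'b::comm_monoid_add"
  assumes "\<And>a c. Q (Poly_Mapping.single a c)" "\<And>p q. Q p \<Longrightarrow> Q q \<Longrightarrow> Q (p + q)"
  shows "Q P"
proof -
  have "Q (\<Sum>a\<in>S. Poly_Mapping.single a (Poly_Mapping.lookup P a))" if "finite S" for S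
    using that
  proof induction
    case empty
    show ?case using assms(1)[of undefined 0] by simp
  next
    case (insert x F)
    then show ?case using assms by simp
  qed
  from this[OF finite_keys, of P] show ?thesis by (simp add: poly_mapping_sum_single)
qed

abbreviation expo :: "nat \<Rightarrow> nat \<Rightarrow>\<^sub>0 nat" where
  "expo i \<equiv> Poly_Mapping.single i 1"

lemma dD_add: "dD (P + Q) = dD P + dD Q"
  unfolding dD_def
  by (rule setsum_keys_plus_distrib)
     (simp_all add: single_add[symmetric] sum.distrib[symmetric] distrib_right)

text \<open>Enlarging the index set adds only zero terms; two monomials and their product can then
  be differentiated over one common set.\<close>

lemma dD_single_superset:
  assumes "finite S" "Poly_Mapping.keys a \<subseteq> S"
  shows "dD (Poly_Mapping.single a c)
    = (\<Sum>i\<in>S. Poly_Mapping.single (a - expo i + expo (Suc i)) (c * of_nat (Poly_Mapping.lookup a i)))"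
proof -
  have "dD (Poly_Mapping.single a c) = (\<Sum>i\<in>Poly_Mapping.keys a.
      Poly_Mapping.single (a - expo i + expo (Suc i)) (c * of_nat (Poly_Mapping.lookup a i)))"
    by (cases "c = 0") (simp_all add: dD_def)
  also have "\<dots> = (\<Sum>i\<in>S. Poly_Mapping.single (a - expo i + expo (Suc i))
      (c * of_nat (Poly_Mapping.lookup a i)))"
    using assms by (intro sum.mono_neutral_left) (auto simp: in_keys_iff)
  finally show ?thesis .
qed

text \<open>Exponents are subtracted with truncation, so the variable must occur in
  \<open>a\<close>. Where it does not, the coefficient in \<open>dD\<close> is zero.\<close>

lemma expo_shift_add:
  assumes "Poly_Mapping.lookup a i > 0"
  shows "a + b - expo i + expo (Suc i) = (a - expo i + expo (Suc i)) + b"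
  by (rule poly_mapping_eqI)
     (use assms in \<open>auto simp: lookup_add lookup_minus lookup_single when_def\<close>)

lemma dD_mult_single:
  "dD (Poly_Mapping.single a c * Poly_Mapping.single b d)
    = dD (Poly_Mapping.single a c) * Poly_Mapping.single b d
      + Poly_Mapping.single a c * dD (Poly_Mapping.single b d)"
proof -
  let ?S = "Poly_Mapping.keys a \<union> Poly_Mapping.keys b"
  let ?l = Poly_Mapping.lookup
  have S: "finite ?S" "Poly_Mapping.keys a \<subseteq> ?S" "Poly_Mapping.keys b \<subseteq> ?S"
    "Poly_Mapping.keys (a + b) \<subseteq> ?S" by (auto simp: keys_add)
  have 1: "Poly_Mapping.single (a + b - expo i + expo (Suc i)) (c * d * of_nat (?l a i))
      = Poly_Mapping.single (a - expo i + expo (Suc i)) (c * of_nat (?l a i)) * Poly_Mapping.single b d" for i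
  proof (cases "?l a i > 0")
    case True
    show ?thesis unfolding expo_shift_add[OF True] mult_single by (simp add: mult_ac)
  qed simp
  have 2: "Poly_Mapping.single (a + b - expo i + expo (Suc i)) (c * d * of_nat (?l b i))
      = Poly_Mapping.single a c * Poly_Mapping.single (b - expo i + expo (Suc i)) (d * of_nat (?l b i))" for i
    by (cases "?l b i > 0")
       (simp_all add: expo_shift_add[of b i a] add.commute[of a] mult_single mult.assoc del: One_nat_def)
  have "dD (Poly_Mapping.single a c * Poly_Mapping.single b d)
      = (\<Sum>i\<in>?S. Poly_Mapping.single (a + b - expo i + expo (Suc i)) (c * d * of_nat (?l a i))
           + Poly_Mapping.single (a + b - expo i + expo (Suc i)) (c * d * of_nat (?l b i)))"
    unfolding mult_single dD_single_superset[OF S(1,4)]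
    by (simp add: lookup_add distrib_left single_add)
  then show ?thesis
    unfolding 1 2 sum.distrib sum_distrib_left[symmetric] sum_distrib_right[symmetric]
      dD_single_superset[OF S(1,2)] dD_single_superset[OF S(1,3)] .
qed

lemma dD_mult: "dD (P * Q) = dD P * Q + P * dD Q"
proof (induction P rule: poly_mapping_single_add_induct)
  case (single a c)
  show ?case
    by (induction Q rule: poly_mapping_single_add_induct)
       (simp_all add: dD_mult_single dD_add algebra_simps)
qed (simp add: dD_add algebra_simps)

interpretation dpoly: diff_ring dD dconst
proof
  show "dD (dconst c) = 0" for c
    by (simp add: dconst_def dD_single_superset[of "{}"])
qed (simp_all add: dD_add dD_mult dconst_def single_add mult_single)

lemma dD_dvar: "dD (dvar i) = dvar (Suc i)"
  by (simp add: dvar_def dD_single_superset[of "{i}"])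

text \<open>Take the highest variable u_n in P and a monomial \<open>a\<close> containing it.
  Replacing one factor u_n of \<open>a\<close> by u_(n+1) gives a monomial that arises in
  \<open>dD P\<close> in one way only, so its coefficient cannot cancel.\<close>

lemma dD_eq_0_imp:
  assumes "dD P = 0" "Poly_Mapping.lookup P 0 = 0"
  shows "P = 0"
proof (rule ccontr)
  let ?l = Poly_Mapping.lookup and ?k = Poly_Mapping.keys
  assume "P \<noteq> 0"
  define V where "V = (\<Union>a\<in>?k P. ?k a)"
  have finV: "finite V" by (simp add: V_def)
  have "V \<noteq> {}"
  proof
    assume "V = {}"
    then have "\<forall>a\<in>?k P. a = 0" by (auto simp: V_def)
    then have "?k P = {}" using assms(2) by (metis all_not_in_conv in_keys_iff)
    then show False using \<open>P \<noteq> 0\<close> by simp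
  qed
  define n where "n = Max V"
  have "n \<in> V" using finV \<open>V \<noteq> {}\<close> by (simp add: n_def)
  then obtain a where a: "a \<in> ?k P" "n \<in> ?k a" by (auto simp: V_def)
  have le: "i \<le> n" if "b \<in> ?k P" "i \<in> ?k b" for b i
    unfolding n_def using that by (intro Max_ge finV) (auto simp: V_def)
  have top: "?l b (Suc n) = 0" if "b \<in> ?k P" for b
    using le[OF that, of "Suc n"] by (auto simp: in_keys_iff)
  define t where "t = a - expo n + expo (Suc n)"
  \<comment> \<open>No monomial of P contains u_(n+1), while \<open>t\<close> contains it once. So
    the differentiated factor was u_n, and undoing the replacement returns \<open>a\<close>.\<close>
  have eq: "b = a \<and> i = n" if "b \<in> ?k P" "i \<in> ?k b" "b - expo i + expo (Suc i) = t" for b i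
  proof -
    have "?l (b - expo i + expo (Suc i)) (Suc n) = ?l t (Suc n)" using that by simp
    then have i: "i = n"
      using top[OF that(1)] top[OF a(1)]
      by (auto simp: t_def lookup_add lookup_minus lookup_single when_def split: if_splits)
    have "?l b j = ?l a j" for j
    proof -
      have "?l (b - expo i + expo (Suc i)) j = ?l t j" using that by simp
      then show ?thesis using i that(2) a(2)
        by (auto simp: t_def lookup_add lookup_minus lookup_single when_def in_keys_iff split: if_splits)
    qed
    then show ?thesis using i by (auto intro: poly_mapping_eqI)
  qed
  have "0 = ?l (dD P) t" using assms by simp
  also have "\<dots> = (\<Sum>b\<in>?k P. \<Sum>i\<in>?k b. (?l P b * of_nat (?l b i) when b - expo i + expo (Suc i) = t))"
    by (simp add: dD_def lookup_sum lookup_single)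
  also have "\<dots> = (\<Sum>b\<in>?k P. if b = a then ?l P a * of_nat (?l a n) else 0)"
  proof (intro sum.cong refl)
    fix b assume b: "b \<in> ?k P"
    show "(\<Sum>i\<in>?k b. (?l P b * of_nat (?l b i) when b - expo i + expo (Suc i) = t))
      = (if b = a then ?l P a * of_nat (?l a n) else 0)"
    proof (cases "b = a")
      case True
      have "(\<Sum>i\<in>?k a. (?l P a * of_nat (?l a i) when a - expo i + expo (Suc i) = t))
        = (\<Sum>i\<in>?k a. if i = n then ?l P a * of_nat (?l a n) else 0)"
        using eq[OF a(1)] by (intro sum.cong) (auto simp: when_def t_def)
      then show ?thesis using True a by simp
    next
      case False
      then have "b - expo i + expo (Suc i) \<noteq> t" if "i \<in> ?k b" for i
        using eq[OF b that] by blast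
      then have "(\<Sum>i\<in>?k b. (?l P b * of_nat (?l b i) when b - expo i + expo (Suc i) = t)) = 0"
        by (intro sum.neutral) (simp add: when_def del: One_nat_def)
      then show ?thesis using False by simp
    qed
  qed
  also have "\<dots> = ?l P a * of_nat (?l a n)" using a by simp
  also have "\<dots> \<noteq> 0" using a by (simp add: in_keys_iff)
  finally show False by simp
qed

section \<open>Evaluation of differential polynomials in a differential ring\<close>

context diff_ring
begin

definition mon :: "'a \<Rightarrow> (nat \<Rightarrow>\<^sub>0 nat) \<Rightarrow> 'a" where
  "mon u a = (\<Prod>i\<in>Poly_Mapping.keys a. ((D ^^ i) u) ^ Poly_Mapping.lookup a i)"

definition dev :: "'a \<Rightarrow> dpoly \<Rightarrow> 'a" where
  "dev u P = (\<Sum>a\<in>Poly_Mapping.keys P. \<kappa> (Poly_Mapping.lookup P a) * mon u a)"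

lemma mon_superset:
  assumes "finite S" "Poly_Mapping.keys a \<subseteq> S"
  shows "mon u a = (\<Prod>i\<in>S. ((D ^^ i) u) ^ Poly_Mapping.lookup a i)"
  unfolding mon_def using assms by (intro prod.mono_neutral_left) (auto simp: in_keys_iff)

lemma mon_add: "mon u (a + b) = mon u a * mon u b"
proof -
  let ?S = "Poly_Mapping.keys a \<union> Poly_Mapping.keys b"
  have S: "finite ?S" "Poly_Mapping.keys a \<subseteq> ?S" "Poly_Mapping.keys b \<subseteq> ?S"
    "Poly_Mapping.keys (a + b) \<subseteq> ?S" by (auto simp: keys_add)
  show ?thesis
    unfolding mon_superset[OF S(1,2)] mon_superset[OF S(1,3)] mon_superset[OF S(1,4)]
    by (simp add: lookup_add power_add prod.distrib)
qed

lemma mon_single: "mon u (Poly_Mapping.single i n) = ((D ^^ i) u) ^ n"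
  by (simp add: mon_superset[of "{i}"])

lemma dev_add: "dev u (P + Q) = dev u P + dev u Q"
  unfolding dev_def
  by (rule setsum_keys_plus_distrib) (simp_all add: const_add distrib_right)

lemma dev_single: "dev u (Poly_Mapping.single a c) = \<kappa> c * mon u a"
  by (cases "c = 0") (simp_all add: dev_def)

lemma dev_mult: "dev u (P * Q) = dev u P * dev u Q"
proof (induction P rule: poly_mapping_single_add_induct)
  case (single a c)
  show ?case
    by (induction Q rule: poly_mapping_single_add_induct)
       (simp_all add: dev_single mult_single const_mult mon_add dev_add algebra_simps)
qed (simp add: dev_add algebra_simps)

text \<open>Both sides obey the Leibniz rule, which reduces the claim to powers of a single
  variable.\<close>

lemma dev_dD_monomial: "dev u (dD (Poly_Mapping.single a 1)) = D (dev u (Poly_Mapping.single a 1))"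
proof (induction a rule: poly_mapping_single_add_induct)
  case (single i n)
  have "dD (Poly_Mapping.single (Poly_Mapping.single i n) 1)
      = Poly_Mapping.single (Poly_Mapping.single i n - expo i + expo (Suc i)) (of_nat n)"
    by (simp add: dD_single_superset[of "{i}"])
  also have "Poly_Mapping.single i n - expo i + expo (Suc i)
      = Poly_Mapping.single i (n - 1) + expo (Suc i)"
    by (simp add: single_diff)
  finally show ?case
    by (simp add: dev_single mon_add mon_single const_of_nat D_power const_1)
next
  case (add a b)
  have e: "Poly_Mapping.single (a + b) (1 :: real) = Poly_Mapping.single a 1 * Poly_Mapping.single b 1"
    by (simp add: mult_single)
  show ?case unfolding e dD_mult dev_add dev_mult D_mult add ..
qed

lemma dev_dconst: "dev u (dconst c) = \<kappa> c"
  by (simp add: dconst_def dev_single mon_def)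

lemma dev_dD: "dev u (dD P) = D (dev u P)"
proof (induction P rule: poly_mapping_single_add_induct)
  case (single a c)
  have e: "Poly_Mapping.single a c = dconst c * Poly_Mapping.single a 1"
    by (simp add: dconst_def mult_single)
  show ?case
    unfolding e dpoly.D_const_mult dev_mult dev_dconst D_const_mult dev_dD_monomial ..
qed (simp add: dD_add dev_add D_add)

lemma dev_hom: "diff_ring_hom dD dconst D \<kappa> (dev u)"
  by unfold_locales (simp_all add: dev_add dev_mult dev_dconst dev_dD)

lemma dev_dvar: "dev u (dvar i) = (D ^^ i) u"
  by (simp add: dvar_def dev_single mon_single const_1)

lemma gd_eq_unique:
  assumes "A $ 0 = 1" "A\<^sup>2 = 1 + fps_X * gd_op rc u A"
    and "B $ 0 = 1" "B\<^sup>2 = 1 + fps_X * gd_op rc u B"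
  shows "A = B"
  by (rule sqrt_eq_unique[OF two_const_half, of "gd_op rc u"]) (use assms gd_op_causal in auto)

end

text \<open>Solving over differential polynomials is what integrates the recursion: the coefficients
  of the solution are differential polynomials from the start.\<close>

lemma gd_dpoly_exists:
  "\<exists>A. A $ 0 = 1 \<and> A\<^sup>2 = 1 + fps_X * dpoly.gd_op rc (dvar 0) A"
proof -
  have "\<exists>A. A $ 0 = 1 \<and> A\<^sup>2 = 1 + fps_X * dpoly.gd_op rc (dvar 0) A
      \<and> (\<forall>n. \<exists>G\<in>UNIV. A $ n = G $ n)"
    by (rule sqrt_eq_exists[OF dpoly.two_const_half, of "dpoly.gd_op rc (dvar 0)"])
       (use dpoly.gd_op_causal in auto)
  then show ?thesis by blast
qed

definition gd_dpoly :: "real \<Rightarrow> dpoly fps" where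
  "gd_dpoly rc = (SOME A. A $ 0 = 1 \<and> A\<^sup>2 = 1 + fps_X * dpoly.gd_op rc (dvar 0) A)"

lemma gd_dpoly: "gd_dpoly rc $ 0 = 1"
    "(gd_dpoly rc)\<^sup>2 = 1 + fps_X * dpoly.gd_op rc (dvar 0) (gd_dpoly rc)"
  using someI_ex[OF gd_dpoly_exists[of rc]] unfolding gd_dpoly_def by blast+

context diff_ring
begin

text \<open>Evaluation at u maps the universal solution to a solution over the given ring, and that
  solution is unique.\<close>

lemma gd_eq_imp_dev:
  assumes "A $ 0 = 1" "A\<^sup>2 = 1 + fps_X * gd_op rc u A"
  shows "A $ j = dev u (gd_dpoly rc $ j)"
proof -
  interpret H: diff_ring_hom dD dconst D \<kappa> "dev u" by (rule dev_hom)
  have "(H.hf (gd_dpoly rc))\<^sup>2 = H.hf ((gd_dpoly rc)\<^sup>2)"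
    by (simp add: H.hf_mult power2_eq_square)
  also have "\<dots> = 1 + fps_X * gd_op rc u (H.hf (gd_dpoly rc))"
    unfolding gd_dpoly(2)
    by (simp add: H.hf_add H.hf_mult H.hf_1 H.hf_X H.hf_gd_op dev_dvar)
  finally have "A = H.hf (gd_dpoly rc)"
    by (intro gd_eq_unique[OF assms]) (simp_all add: gd_dpoly)
  then show ?thesis by simp
qed

end

text \<open>Evaluate at u = 0 in the reals with zero derivation. The equation becomes A^2 = 1, so A
  = 1, while evaluation at 0 reads off the constant term.\<close>

lemma gd_dpoly_lookup_0: "Poly_Mapping.lookup (gd_dpoly rc $ Suc j) 0 = 0"
proof -
  let ?D = "\<lambda>_ :: real. 0 :: real" and ?\<kappa> = "\<lambda>c :: real. c"
  have R: "diff_ring ?D ?\<kappa>" by unfold_locales auto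
  have d: "diff_ring.Dh ?D F = 0" for F
    by (rule fps_ext) (simp add: diff_ring.Dh_nth[OF R])
  have g: "(1 :: real fps)\<^sup>2 = 1 + fps_X * diff_ring.gd_op ?D ?\<kappa> rc 0 1"
    unfolding diff_ring.gd_op_def[OF R] d by simp
  have z: "(?D ^^ i) 0 = 0" for i
    by (rule diff_ring.funpow_D_0[OF R])
  have m: "diff_ring.mon ?D 0 a = (if a = 0 then 1 else 0)" for a
  proof (cases "a = 0")
    case False
    then obtain i where "i \<in> Poly_Mapping.keys a" by (metis all_not_in_conv keys_eq_empty)
    then have "\<exists>i\<in>Poly_Mapping.keys a. (0 :: real) ^ Poly_Mapping.lookup a i = 0"
      by (auto simp: in_keys_iff)
    then show ?thesis using False unfolding diff_ring.mon_def[OF R] z by (simp add: prod_zero)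
  qed (simp add: diff_ring.mon_def[OF R])
  have "0 = diff_ring.dev ?D ?\<kappa> 0 (gd_dpoly rc $ Suc j)"
    using diff_ring.gd_eq_imp_dev[OF R _ g, of "Suc j"] by simp
  also have "\<dots> = (\<Sum>a\<in>Poly_Mapping.keys (gd_dpoly rc $ Suc j).
      if a = 0 then Poly_Mapping.lookup (gd_dpoly rc $ Suc j) a else 0)"
    unfolding diff_ring.dev_def[OF R] m by (intro sum.cong) auto
  also have "\<dots> = Poly_Mapping.lookup (gd_dpoly rc $ Suc j) 0"
    unfolding sum.delta[OF finite_keys] by (auto simp: in_keys_iff)
  finally show ?thesis by simp
qed

text \<open>This shows that the description by \<open>THE\<close> is met exactly once: the universal
  solution gives existence, and the kernel of \<open>dD\<close> gives uniqueness.\<close>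

lemma Rpoly_eq_gd_dpoly: "Rpoly rc j = gd_dpoly rc $ j"
proof (induction j)
  case (Suc j)
  let ?R = "dconst rc * dD (dD (dD (Rpoly rc j)))
      + dconst 4 * dvar 0 * dD (Rpoly rc j) + dconst 2 * dvar 1 * Rpoly rc j"
  have R: "dD (gd_dpoly rc $ Suc j) = ?R"
    using dpoly.gd_eq_imp_lenard[OF gd_dpoly, of rc j]
    by (simp add: Suc dD_dvar dpoly.const_numeral)
  have "P = gd_dpoly rc $ Suc j" if "dD P = ?R \<and> Poly_Mapping.lookup P 0 = 0" for P
  proof -
    have "dD (P - gd_dpoly rc $ Suc j) = 0"
      by (simp only: dpoly.D_diff R that diff_self)
    moreover have "Poly_Mapping.lookup (P - gd_dpoly rc $ Suc j) 0 = 0"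
      by (simp only: lookup_minus gd_dpoly_lookup_0 that diff_self)
    ultimately have "P - gd_dpoly rc $ Suc j = 0" by (rule dD_eq_0_imp)
    then show ?thesis by (rule eq_iff_diff_eq_0[THEN iffD2])
  qed
  with R show ?case
    unfolding Rpoly.simps by (intro the_equality conjI gd_dpoly_lookup_0)
qed (simp add: gd_dpoly)

section \<open>Solution of the string equation and its double scaling limit\<close>

context diff_ring
begin

text \<open>The derivation acts on coefficients only, so the indeterminate s is a constant, as 1 /
  (\<lambda> - 4 r_c) is with respect to x.\<close>

lemma diff_ring_poly: "diff_ring (map_poly D) (\<lambda>c. [:\<kappa> c:])"
proof
  show "map_poly D (p * q) = map_poly D p * q + p * map_poly D q" for p q
    by (rule poly_eqI) (simp add: coeff_map_poly coeff_mult D_sum D_mult sum.distrib)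
  show "map_poly D (p + q) = map_poly D p + map_poly D q" for p q
    by (rule poly_eqI) (simp add: coeff_map_poly D_add)
qed (simp_all add: map_poly_pCons D_const const_add const_mult const_1 pCons_one)

lemma poly_eval_hom:
  assumes "D s = 0"
  shows "diff_ring_hom (map_poly D) (\<lambda>c. [:\<kappa> c:]) D \<kappa> (\<lambda>p. poly p s)"
proof -
  interpret P: diff_ring "map_poly D" "\<lambda>c. [:\<kappa> c:]" by (rule diff_ring_poly)
  have "poly (map_poly D p) s = D (poly p s)" for p
    by (induction p) (simp_all add: map_poly_pCons D_add D_mult assms)
  then show ?thesis by unfold_locales simp_all
qed

interpretation P: diff_ring "map_poly D" "\<lambda>c. [:\<kappa> c:]"
  by (rule diff_ring_poly)

text \<open>The weight counts \<open>s\<close> as \<open>2\<close> and matches it against the power of \<open>\<epsilon>\<close>; the coefficients of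
  exact weight \<open>2k\<close> survive in the double scaling limit.\<close>

definition weight_bounded :: "'a poly fps \<Rightarrow> bool" where
  "weight_bounded F \<longleftrightarrow> (\<forall>N j. N < 2 * j \<longrightarrow> coeff (F $ N) j = 0)"

definition top_part :: "'a poly fps \<Rightarrow> 'a fps" where
  "top_part F = Abs_fps (\<lambda>k. coeff (F $ (2 * k)) k)"

lemma top_part_nth [simp]: "top_part F $ k = coeff (F $ (2 * k)) k"
  by (simp add: top_part_def)

lemma weight_boundedD: "weight_bounded F \<Longrightarrow> N < 2 * j \<Longrightarrow> coeff (F $ N) j = 0"
  by (simp add: weight_bounded_def)

lemma weight_bounded_add: "weight_bounded F \<Longrightarrow> weight_bounded G \<Longrightarrow> weight_bounded (F + G)"
  by (simp add: weight_bounded_def)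

lemma weight_bounded_diff: "weight_bounded F \<Longrightarrow> weight_bounded G \<Longrightarrow> weight_bounded (F - G)"
  by (simp add: weight_bounded_def)

lemma weight_bounded_mult:
  assumes "weight_bounded F" "weight_bounded G"
  shows "weight_bounded (F * G)"
  unfolding weight_bounded_def
proof (intro allI impI)
  fix N j :: nat assume N: "N < 2 * j"
  have "coeff (F $ i) a * coeff (G $ (N - i)) (j - a) = 0" if "i \<le> N" "a \<le> j" for i a
  proof (cases "i < 2 * a")
    case False
    then have "N - i < 2 * (j - a)" using that N by linarith
    then show ?thesis using weight_boundedD[OF assms(2)] by simp
  qed (use weight_boundedD[OF assms(1)] in simp)
  then show "coeff ((F * G) $ N) j = 0"
    by (simp add: fps_mult_nth coeff_sum coeff_mult)
qed

lemma weight_bounded_lift: "weight_bounded (Abs_fps (\<lambda>n. [:f n:]))"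
  by (auto simp: weight_bounded_def coeff_pCons split: nat.split)

lemma weight_bounded_const: "weight_bounded (fps_const [:c:])"
  by (auto simp: weight_bounded_def coeff_pCons split: nat.split)

lemma weight_bounded_1: "weight_bounded 1"
  using weight_bounded_const[of 1] by (simp add: pCons_one)

lemma weight_bounded_numeral: "weight_bounded (numeral n)"
  using weight_bounded_const[of "numeral n"] by (simp add: numeral_poly numeral_fps_const)

lemma weight_bounded_X_mult: "weight_bounded F \<Longrightarrow> weight_bounded (fps_X * F)"
  by (auto simp: weight_bounded_def)

lemma weight_bounded_Dh: "weight_bounded F \<Longrightarrow> weight_bounded (P.Dh F)"
  by (simp add: weight_bounded_def coeff_map_poly)

lemma coeff_funpow_map_poly_D: "coeff ((map_poly D ^^ n) p) j = (D ^^ n) (coeff p j)"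
  by (induction n) (simp_all add: coeff_map_poly)

lemma weight_bounded_Op: "weight_bounded F \<Longrightarrow> weight_bounded (P.Op c F)"
  by (simp add: weight_bounded_def P.Op_nth coeff_sum coeff_funpow_map_poly_D)

text \<open>A factor s costs weight 2 and is paid for by epsilon^2. The bracketing is the one in
  which \<open>string_op\<close> produces these factors.\<close>

lemma weight_bounded_s_X2_mult:
  assumes "weight_bounded F"
  shows "weight_bounded (fps_X * (fps_const [:0, 1:] * (fps_X * F)))"
  unfolding weight_bounded_def
proof (intro allI impI)
  fix N j :: nat assume "N < 2 * j"
  then show "coeff ((fps_X * (fps_const [:0, 1:] * (fps_X * F))) $ N) j = 0"
    using weight_boundedD[OF assms, of "N - 2" "j - 1"]
    by (cases j) (auto simp: coeff_pCons numeral_2_eq_2)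
qed

lemma top_part_add: "top_part (F + G) = top_part F + top_part G"
  by (intro fps_ext) simp

lemma top_part_diff: "top_part (F - G) = top_part F - top_part G"
  by (intro fps_ext) simp

text \<open>In the product at s^k epsilon^(2k), a pair of terms not balanced as s^a epsilon^(2a) has
  a factor beyond its weight bound, which vanishes. So the top part is multiplicative.\<close>

lemma top_part_mult:
  assumes "weight_bounded F" "weight_bounded G"
  shows "top_part (F * G) = top_part F * top_part G"
proof (intro fps_ext)
  fix k
  have "top_part (F * G) $ k
      = (\<Sum>a\<le>k. \<Sum>i=0..2*k. coeff (F $ i) a * coeff (G $ (2 * k - i)) (k - a))"
    unfolding top_part_nth fps_mult_nth coeff_sum coeff_mult by (rule sum.swap)
  also have "\<dots> = (\<Sum>a\<le>k. coeff (F $ (2 * a)) a * coeff (G $ (2 * (k - a))) (k - a))"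
  proof (intro sum.cong refl)
    fix a assume a: "a \<in> {..k}"
    have "(\<Sum>i=0..2*k. coeff (F $ i) a * coeff (G $ (2 * k - i)) (k - a))
        = (\<Sum>i=0..2*k. if i = 2 * a then coeff (F $ (2 * a)) a * coeff (G $ (2 * (k - a))) (k - a) else 0)"
    proof (intro sum.cong refl)
      fix i assume i: "i \<in> {0..2 * k}"
      consider "i < 2 * a" | "i = 2 * a" | "2 * k - i < 2 * (k - a)" using i a by fastforce
      then show "coeff (F $ i) a * coeff (G $ (2 * k - i)) (k - a)
        = (if i = 2 * a then coeff (F $ (2 * a)) a * coeff (G $ (2 * (k - a))) (k - a) else 0)"
        using weight_boundedD[OF assms(1)] weight_boundedD[OF assms(2)]
        by cases (auto simp: diff_mult_distrib2)
    qed
    then show "(\<Sum>i=0..2*k. coeff (F $ i) a * coeff (G $ (2 * k - i)) (k - a))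
        = coeff (F $ (2 * a)) a * coeff (G $ (2 * (k - a))) (k - a)"
      using a by simp
  qed
  also have "\<dots> = (top_part F * top_part G) $ k"
    by (simp add: fps_mult_nth atMost_atLeast0)
  finally show "top_part (F * G) $ k = (top_part F * top_part G) $ k" .
qed

lemma top_part_lift: "top_part (Abs_fps (\<lambda>n. [:f n:])) = fps_const (f 0)"
  by (intro fps_ext) (auto simp: coeff_pCons split: nat.split)

lemma top_part_const: "top_part (fps_const [:c:]) = fps_const c"
  by (intro fps_ext) (auto simp: coeff_pCons split: nat.split)

lemma top_part_1: "top_part 1 = 1"
  using top_part_const[of 1] by (simp add: pCons_one)

lemma top_part_numeral: "top_part (numeral n) = numeral n"
  using top_part_const[of "numeral n"] by (simp add: numeral_poly numeral_fps_const)

text \<open>A power of epsilon with no matching s falls below top weight; this is how the scaling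
  limit discards terms.\<close>

lemma top_part_X_mult: "weight_bounded F \<Longrightarrow> top_part (fps_X * F) = 0"
  by (intro fps_ext) (auto simp: weight_bounded_def)

lemma top_part_s_X2_mult:
  "top_part (fps_X * (fps_const [:0, 1:] * (fps_X * F))) = fps_X * top_part F"
proof (intro fps_ext)
  fix k show "top_part (fps_X * (fps_const [:0, 1:] * (fps_X * F))) $ k = (fps_X * top_part F) $ k"
    by (cases k) (simp_all add: coeff_pCons)
qed

lemma top_part_Dh: "top_part (P.Dh F) = Dh (top_part F)"
  by (intro fps_ext) (simp add: coeff_map_poly)

lemma top_part_Op:
  assumes "weight_bounded F"
  shows "top_part (P.Op c F) = fps_const (\<kappa> (c 0)) * top_part F"
  by (subst P.Op_unfold)
     (simp add: top_part_add top_part_X_mult top_part_mult top_part_const assms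
       weight_bounded_Op weight_bounded_Dh weight_bounded_const)

lemma weight_bounded_shift_rest: "weight_bounded F \<Longrightarrow> weight_bounded (P.shift_rest c F)"
  by (simp add: P.shift_rest_def weight_bounded_Op weight_bounded_Dh)

lemma weight_bounded_string_rest: "weight_bounded F \<Longrightarrow> weight_bounded (P.string_rest F)"
  unfolding P.string_rest_def power2_eq_square mult.assoc
  by (intro weight_bounded_add weight_bounded_diff weight_bounded_mult weight_bounded_X_mult
      weight_bounded_shift_rest weight_bounded_Dh weight_bounded_numeral)

text \<open>Only the leading terms of the two Taylor remainders survive. Each is half of the second
  derivative, since c^2 / 2 = 1 / 2 for c = 1 and c = -1; all other cross terms carry an unmatched
  epsilon.\<close>

lemma top_part_string_rest:
  assumes F: "weight_bounded F"
  shows "top_part (P.string_rest F) = 2 * top_part F * Dh (Dh (top_part F)) - (Dh (top_part F))\<^sup>2"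
proof -
  have s: "top_part (P.shift_rest c F) = fps_const (\<kappa> (c\<^sup>2 / 2)) * Dh (Dh (top_part F))" for c
    unfolding P.shift_rest_def
    by (subst top_part_Op) (simp_all add: F weight_bounded_Dh top_part_Dh power2_eq_square)
  have "fps_const (\<kappa> (1 / 2)) * H + fps_const (\<kappa> (1 / 2)) * H = H" for H :: "'a fps"
  proof -
    have "fps_const (\<kappa> (1 / 2)) * H + fps_const (\<kappa> (1 / 2)) * H = fps_const (2 * \<kappa> (1 / 2)) * H"
      by (simp only: mult_2 fps_const_add[symmetric] distrib_right)
    then show ?thesis by (simp only: two_const_half fps_const_1_eq_1 mult_1)
  qed
  then have ss: "top_part (P.shift_rest 1 F) + top_part (P.shift_rest (-1) F) = Dh (Dh (top_part F))"
    by (simp add: s)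
  note wb = weight_bounded_add weight_bounded_diff weight_bounded_mult weight_bounded_X_mult
      weight_bounded_shift_rest weight_bounded_Dh weight_bounded_numeral F
  show ?thesis
    unfolding P.string_rest_def power2_eq_square mult.assoc
    by (simp only: top_part_add top_part_diff top_part_mult wb top_part_X_mult top_part_numeral
        top_part_Dh ss add_0_right)
qed

lemma weight_bounded_string_op:
  assumes "weight_bounded F"
  shows "weight_bounded (fps_X * P.string_op rc (Abs_fps (\<lambda>n. [:f n:])) [:0, 1:] F)"
  unfolding P.string_op_def power2_eq_square mult.assoc
  by (intro weight_bounded_s_X2_mult weight_bounded_add weight_bounded_mult weight_bounded_X_mult
      weight_bounded_string_rest weight_bounded_numeral weight_bounded_lift weight_bounded_const assms)

text \<open>The double scaling limit: the string equation becomes the Gelfand-Dickey equation with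
  potential \<open>f 0\<close>, the leading correction to r_c.\<close>

lemma top_part_string_op:
  assumes F: "weight_bounded F"
  shows "top_part (fps_X * P.string_op rc (Abs_fps (\<lambda>n. [:f n:])) [:0, 1:] F)
    = fps_X * gd_op rc (f 0) (top_part F)"
proof -
  note wb = weight_bounded_add weight_bounded_diff weight_bounded_mult weight_bounded_X_mult
      weight_bounded_lift weight_bounded_const weight_bounded_string_rest weight_bounded_numeral F
  show ?thesis
    unfolding P.string_op_def gd_op_def power2_eq_square
    by (simp only: top_part_s_X2_mult top_part_add top_part_mult wb top_part_X_mult top_part_numeral
        mult.assoc top_part_lift top_part_const top_part_string_rest power2_eq_square add_0_right)
qed

text \<open>Solve once with s as an indeterminate, using the weight bound as the invariant of the
  iteration. By uniqueness, evaluation at a constant s reproduces every solution with constant term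
  1.\<close>

theorem string_solution:
  "\<exists>Q :: 'a poly fps.
     (\<forall>N j. N < 2 * j \<longrightarrow> coeff (Q $ N) j = 0) \<and> (\<forall>N>0. coeff (Q $ N) 0 = 0) \<and>
     (\<forall>k. coeff (Q $ (2 * k)) k = dev (\<rho> $ 0) (Rpoly rc k)) \<and>
     (\<forall>s F N. D s = 0 \<longrightarrow> F $ 0 = 1 \<longrightarrow> F\<^sup>2 = 1 + fps_X * string_op rc \<rho> s F
        \<longrightarrow> F $ N = poly (Q $ N) s)"
proof -
  define \<rho>p where "\<rho>p = Abs_fps (\<lambda>n. [:\<rho> $ n:])"
  let ?T = "P.string_op rc \<rho>p [:0, 1:]"
  have "\<exists>Q. Q $ 0 = 1 \<and> Q\<^sup>2 = 1 + fps_X * ?T Q \<and> (\<forall>n. \<exists>G\<in>Collect weight_bounded. Q $ n = G $ n)"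
  proof (rule sqrt_eq_exists[OF P.two_const_half])
    show "sqrt_step [:\<kappa> (1 / 2):] ?T F \<in> Collect weight_bounded" if "F \<in> Collect weight_bounded" for F
      using that unfolding sqrt_step_def \<rho>p_def power2_eq_square mem_Collect_eq
      by (intro weight_bounded_add weight_bounded_mult weight_bounded_diff weight_bounded_const
          weight_bounded_1 weight_bounded_string_op)
  qed (use P.string_op_causal weight_bounded_1 in auto)
  then obtain Q where Q: "Q $ 0 = 1" "Q\<^sup>2 = 1 + fps_X * ?T Q"
    and QS: "\<And>n. \<exists>G. weight_bounded G \<and> Q $ n = G $ n" by auto
  have wb: "weight_bounded Q"
    unfolding weight_bounded_def using QS weight_boundedD by metis
  have eval: "F $ N = poly (Q $ N) s"
    if s: "D s = 0" and F: "F $ 0 = 1" "F\<^sup>2 = 1 + fps_X * string_op rc \<rho> s F" for s F N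
  proof -
    interpret H: diff_ring_hom "map_poly D" "\<lambda>c. [:\<kappa> c:]" D \<kappa> "\<lambda>p. poly p s"
      by (rule poly_eval_hom[OF s])
    have \<rho>: "H.hf \<rho>p = \<rho>" by (intro fps_ext) (simp add: \<rho>p_def)
    have "(H.hf Q)\<^sup>2 = H.hf (Q\<^sup>2)" by (simp add: H.hf_mult power2_eq_square)
    also have "\<dots> = 1 + fps_X * string_op rc \<rho> s (H.hf Q)"
      unfolding Q(2) by (simp add: H.hf_add H.hf_mult H.hf_1 H.hf_X H.hf_string_op \<rho>)
    finally have hQ: "(H.hf Q)\<^sup>2 = 1 + fps_X * string_op rc \<rho> s (H.hf Q)" .
    have "F = H.hf Q"
      by (rule sqrt_eq_unique[where T = "string_op rc \<rho> s",
            OF two_const_half string_op_causal F _ hQ]) (simp_all add: Q(1))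
    then show ?thesis by simp
  qed
  \<comment> \<open>At s = 0 the equation reads F^2 = 1, and its solution is F = 1.\<close>
  have at_0: "1 $ N = poly (Q $ N) 0" for N
    by (rule eval) (simp_all add: string_op_def)
  have c0: "coeff (Q $ N) 0 = 0" if "N > 0" for N
    using that at_0[of N] by (simp add: poly_0_coeff_0)
  have "(top_part Q)\<^sup>2 = top_part (Q\<^sup>2)" by (simp add: top_part_mult wb power2_eq_square)
  also have "\<dots> = 1 + fps_X * gd_op rc (\<rho> $ 0) (top_part Q)"
    unfolding Q(2) \<rho>p_def by (simp only: top_part_add top_part_1 top_part_string_op[OF wb])
  finally have tQ: "(top_part Q)\<^sup>2 = 1 + fps_X * gd_op rc (\<rho> $ 0) (top_part Q)" .
  have "top_part Q $ k = dev (\<rho> $ 0) (gd_dpoly rc $ k)" for k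
    by (rule gd_eq_imp_dev[OF _ tQ]) (simp add: Q(1))
  then have "coeff (Q $ (2 * k)) k = dev (\<rho> $ 0) (Rpoly rc k)" for k
    by (simp add: Rpoly_eq_gd_dpoly)
  with wb c0 eval show ?thesis unfolding weight_bounded_def by blast
qed

end

section \<open>Jets of smooth functions\<close>

definition jet :: "(real \<Rightarrow> complex) \<Rightarrow> real \<Rightarrow> complex fps" where
  "jet f x = Abs_fps (\<lambda>n. nderiv n f x / fact n)"

text \<open>The derivative condition says that \<open>G x\<close> is the Taylor series of f at x. In
  this form it passes to sums and products by the Leibniz rule, without formulas for iterated
  derivatives.\<close>

definition has_jet :: "real set \<Rightarrow> (real \<Rightarrow> complex) \<Rightarrow> (real \<Rightarrow> complex fps) \<Rightarrow> bool" where
  "has_jet I f G \<longleftrightarrow> (\<forall>x\<in>I. G x $ 0 = f x \<and>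
     (\<forall>n. ((\<lambda>y. G y $ n) has_vector_derivative fps_deriv (G x) $ n) (at x)))"

lemma nderiv_0 [simp]: "nderiv 0 f = f"
  by (simp add: nderiv_def)

lemma nderiv_Suc: "nderiv (Suc n) f x = vector_derivative (nderiv n f) (at x)"
  by (simp add: nderiv_def)

lemma has_jet_jet:
  assumes "smooth_on I f"
  shows "has_jet I f (jet f)"
  unfolding has_jet_def
proof (intro ballI conjI allI)
  fix x n assume x: "x \<in> I"
  have "(nderiv n f has_vector_derivative nderiv (Suc n) f x) (at x)"
    using assms x by (simp add: smooth_on_def)
  then have "((\<lambda>y. nderiv n f y / fact n) has_vector_derivative nderiv (Suc n) f x / fact n) (at x)"
    by (rule has_vector_derivative_divide)
  moreover have "nderiv (Suc n) f x / fact n = fps_deriv (jet f x) $ n"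
    using of_nat_neq_0[of n, where 'a = complex] by (simp add: jet_def)
  ultimately show "((\<lambda>y. jet f y $ n) has_vector_derivative fps_deriv (jet f x) $ n) (at x)"
    by (simp add: jet_def)
qed (simp add: jet_def)

lemma has_jet_nderiv:
  assumes "has_jet I f G" "open I" "x \<in> I"
  shows "nderiv n f x = fact n * G x $ n"
  using \<open>x \<in> I\<close>
proof (induction n arbitrary: x)
  case (Suc n)
  have "((\<lambda>y. G y $ n) has_vector_derivative fps_deriv (G x) $ n) (at x)"
    using assms(1) Suc.prems by (simp add: has_jet_def)
  then have "((\<lambda>y. fact n * G y $ n) has_vector_derivative fact n * fps_deriv (G x) $ n) (at x)"
    by (rule has_vector_derivative_mult_right)
  then have "(nderiv n f has_vector_derivative fact n * fps_deriv (G x) $ n) (at x)"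
    by (rule has_vector_derivative_transform_within_open[OF _ assms(2) Suc.prems])
       (simp add: Suc.IH)
  then have "nderiv (Suc n) f x = fact n * fps_deriv (G x) $ n"
    unfolding nderiv_Suc by (rule vector_derivative_at)
  then show ?case by (simp add: algebra_simps)
qed (use assms in \<open>simp add: has_jet_def\<close>)

text \<open>This turns an identity of functions on the open set I into an identity of jets at each
  point.\<close>

lemma has_jet_unique:
  assumes "has_jet I f G" "has_jet I f H" "open I" "x \<in> I"
  shows "G x = H x"
proof (rule fps_ext)
  fix n
  have "fact n * G x $ n = fact n * H x $ n"
    using has_jet_nderiv[OF assms(1,3,4), of n] has_jet_nderiv[OF assms(2,3,4), of n] by simp
  then show "G x $ n = H x $ n" by simp
qed

lemma has_jet_cong:
  assumes "has_jet I f G" "\<And>x. x \<in> I \<Longrightarrow> f x = g x"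
  shows "has_jet I g G"
  using assms by (simp add: has_jet_def)

lemma has_jet_const: "has_jet I (\<lambda>_. c) (\<lambda>_. fps_const c)"
  by (simp add: has_jet_def)

lemma has_jet_add:
  "has_jet I f F \<Longrightarrow> has_jet I g G \<Longrightarrow> has_jet I (\<lambda>x. f x + g x) (\<lambda>x. F x + G x)"
  by (auto simp: has_jet_def distrib_left intro!: has_vector_derivative_add)

lemma has_jet_diff:
  "has_jet I f F \<Longrightarrow> has_jet I g G \<Longrightarrow> has_jet I (\<lambda>x. f x - g x) (\<lambda>x. F x - G x)"
  by (auto simp: has_jet_def right_diff_distrib intro!: has_vector_derivative_diff)

lemma has_jet_mult:
  assumes "has_jet I f F" "has_jet I g G"
  shows "has_jet I (\<lambda>x. f x * g x) (\<lambda>x. F x * G x)"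
  unfolding has_jet_def
proof (intro ballI conjI allI)
  fix x n assume x: "x \<in> I"
  have d: "((\<lambda>y. F y $ m) has_vector_derivative fps_deriv (F x) $ m) (at x)"
    "((\<lambda>y. G y $ m) has_vector_derivative fps_deriv (G x) $ m) (at x)" for m
    using assms x unfolding has_jet_def by blast+
  have "((\<lambda>y. \<Sum>i=0..n. F y $ i * G y $ (n - i)) has_vector_derivative
      (\<Sum>i=0..n. F x $ i * fps_deriv (G x) $ (n - i) + fps_deriv (F x) $ i * G x $ (n - i))) (at x)"
    by (intro has_vector_derivative_sum has_vector_derivative_mult d)
  moreover have "fps_deriv (F x * G x) = F x * fps_deriv (G x) + fps_deriv (F x) * G x"
    by simp
  ultimately show "((\<lambda>y. (F y * G y) $ n) has_vector_derivative fps_deriv (F x * G x) $ n) (at x)"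
    unfolding fps_mult_nth sum.distrib[symmetric] fps_add_nth by (simp only: fps_mult_nth fps_add_nth sum.distrib)
qed (use assms in \<open>auto simp: has_jet_def\<close>)

lemma has_jet_sum:
  assumes "\<And>i. i \<in> S \<Longrightarrow> has_jet I (f i) (F i)"
  shows "has_jet I (\<lambda>x. \<Sum>i\<in>S. f i x) (\<lambda>x. \<Sum>i\<in>S. F i x)"
  using assms
proof (induction S rule: infinite_finite_induct)
  case (insert i S)
  then show ?case by (simp add: has_jet_add)
qed (use has_jet_const[of I 0] in simp_all)

lemma has_jet_deriv:
  assumes "has_jet I f G" "open I"
  shows "has_jet I (nderiv k f) (\<lambda>x. (fps_deriv ^^ k) (G x))"
proof (induction k)
  case (Suc k)
  let ?G = "\<lambda>x. (fps_deriv ^^ k) (G x)"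
  show ?case
    unfolding has_jet_def
  proof (intro ballI conjI allI)
    fix x n assume x: "x \<in> I"
    have d: "((\<lambda>y. ?G y $ m) has_vector_derivative fps_deriv (?G x) $ m) (at x)" for m
      using Suc x by (simp add: has_jet_def)
    have "((\<lambda>y. of_nat (n + 1) * ?G y $ (n + 1)) has_vector_derivative
        of_nat (n + 1) * fps_deriv (?G x) $ (n + 1)) (at x)"
      by (rule has_vector_derivative_mult_right[OF d])
    then show "((\<lambda>y. (fps_deriv ^^ Suc k) (G y) $ n) has_vector_derivative
        fps_deriv ((fps_deriv ^^ Suc k) (G x)) $ n) (at x)"
      by (simp add: algebra_simps)
    show "(fps_deriv ^^ Suc k) (G x) $ 0 = nderiv (Suc k) f x"
    proof -
      have "nderiv 1 (nderiv k f) x = fact 1 * ?G x $ 1"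
        by (rule has_jet_nderiv[OF Suc assms(2) x])
      then show ?thesis by (simp add: nderiv_def)
    qed
  qed
qed (use assms in simp)

lemma has_jet_of_real:
  assumes "smooth_on I r"
  shows "has_jet I (\<lambda>x. of_real (r x)) (\<lambda>x. Abs_fps (\<lambda>n. of_real (nderiv n r x / fact n)))"
  unfolding has_jet_def
proof (intro ballI conjI allI)
  fix x n assume x: "x \<in> I"
  have "(nderiv n r has_vector_derivative nderiv (Suc n) r x) (at x)"
    using assms x by (simp add: smooth_on_def)
  then have "((\<lambda>y. nderiv n r y / fact n) has_vector_derivative nderiv (Suc n) r x / fact n) (at x)"
    by (rule has_vector_derivative_divide)
  then have "((\<lambda>y. complex_of_real (nderiv n r y / fact n)) has_vector_derivative
      of_real (nderiv (Suc n) r x / fact n)) (at x)"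
    by (rule bounded_linear.has_vector_derivative[OF bounded_linear_of_real])
  moreover have "complex_of_real (nderiv (Suc n) r x / fact n)
      = fps_deriv (Abs_fps (\<lambda>n. of_real (nderiv n r x / fact n))) $ n"
    using of_nat_neq_0[of n, where 'a = complex] by simp
  ultimately show "((\<lambda>y. Abs_fps (\<lambda>n. complex_of_real (nderiv n r y / fact n)) $ n) has_vector_derivative
      fps_deriv (Abs_fps (\<lambda>n. of_real (nderiv n r x / fact n))) $ n) (at x)"
    by simp
qed simp

lemma diff_ring_jets: "diff_ring fps_deriv (\<lambda>c. fps_const (complex_of_real c))"
  by unfold_locales (auto simp: algebra_simps)

section \<open>Contour integrals\<close>

text \<open>Cauchy's formula for the derivative of order b of u^k at 0. The quotient covers negative
  exponents as well.\<close>

lemma contour_integral_power_quotient: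
  assumes "R > 0"
  shows "((\<lambda>l. l ^ k / l ^ Suc b) has_contour_integral (if k = b then 2 * pi * \<i> else 0)) (circlepath 0 R)"
proof -
  have "((\<lambda>u. u ^ k / (u - 0) ^ Suc b) has_contour_integral
      (2 * pi * \<i>) / fact b * (deriv ^^ b) (\<lambda>u. u ^ k) 0) (circlepath 0 R)"
    by (rule Cauchy_has_contour_integral_higher_derivative_circlepath)
       (use assms in \<open>auto intro!: continuous_intros holomorphic_intros\<close>)
  moreover have "(deriv ^^ b) (\<lambda>u :: complex. u ^ k) 0 = (if k = b then fact b else 0)"
    using higher_deriv_power[of b 0 k 0]
    by (cases "k < b") (auto simp: pochhammer_fact pochhammer_0_left)
  ultimately show ?thesis by (simp split: if_splits)
qed

section \<open>Double factorials, binomial series and derivatives of W\<close>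

lemma two_power_dfact: "2 ^ j * fact j * real (dfact (2 * j - 1)) = fact (2 * j)"
proof (induction j)
  case (Suc j)
  \<comment> \<open>For j = 0 the truncated difference gives \<open>dfact 0 = 1\<close>, in
    agreement with the convention (-1)!! = 1.\<close>
  have "real (dfact (2 * Suc j - 1)) = (2 * real j + 1) * real (dfact (2 * j - 1))"
    by (cases j) (auto simp: algebra_simps)
  moreover have "(2 :: real) ^ Suc j * fact (Suc j) = (2 * real j + 2) * (2 ^ j * fact j)"
    by (simp add: algebra_simps)
  ultimately have "2 ^ Suc j * fact (Suc j) * real (dfact (2 * Suc j - 1))
      = (2 * real j + 2) * (2 * real j + 1) * (2 ^ j * fact j * real (dfact (2 * j - 1)))"
    by (simp only: mult_ac)
  also have "\<dots> = (2 * real j + 2) * (2 * real j + 1) * fact (2 * j)"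
    by (simp only: Suc)
  also have "\<dots> = fact (2 * Suc j)"
    by (simp add: algebra_simps)
  finally show ?case .
qed simp

lemma dfact_pos: "dfact n > 0"
  by (induction n rule: dfact.induct) auto

text \<open>Coefficientwise, this says that the j-th derivative of (1 - 4r)^(-1/2), the generating
  function of the central binomial coefficients, is 2^j (2j - 1)!! (1 - 4r)^(-1/2 - j).\<close>

lemma gbinomial_half_identity:
  "((- 1 / 2 - real j) gchoose n) * (- 4) ^ n * (2 ^ j * real (dfact (2 * j - 1)))
    = real ((2 * (j + n)) choose (j + n)) * fact j * real ((j + n) choose j)"
proof -
  have "((- 1 / 2 - real j) gchoose n) * (- 4) ^ n * (2 ^ j * real (dfact (2 * j - 1)))
      = fact (2 * (j + n)) / (fact (j + n) * fact n)"
  proof (induction n)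
    case 0
    then show ?case using two_power_dfact[of j] by (simp add: field_simps)
  next
    case (Suc n)
    let ?a = "- 1 / 2 - real j" and ?d = "2 ^ j * real (dfact (2 * j - 1))"
    have "real (Suc n) * (?a gchoose Suc n) = (?a - real n) * (?a gchoose n)"
      using gbinomial_mult_1[of ?a n] by (simp add: algebra_simps)
    then have "real (Suc n) * ((?a gchoose Suc n) * (- 4) ^ Suc n * ?d)
        = (?a - real n) * (- 4) * ((?a gchoose n) * (- 4) ^ n * ?d)"
    proof -
      assume h: "real (Suc n) * (?a gchoose Suc n) = (?a - real n) * (?a gchoose n)"
      have "real (Suc n) * ((?a gchoose Suc n) * (- 4) ^ Suc n * ?d)
          = (real (Suc n) * (?a gchoose Suc n)) * (- 4) * ((- 4) ^ n * ?d)"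
        by (simp only: power_Suc mult_ac)
      then show ?thesis unfolding h by (simp only: mult_ac)
    qed
    also have "\<dots> = 2 * (2 * real (j + n) + 1) * (fact (2 * (j + n)) / (fact (j + n) * fact n))"
      unfolding Suc by (simp add: algebra_simps)
    also have "\<dots> = real (Suc n) * (fact (2 * (j + Suc n)) / (fact (j + Suc n) * fact (Suc n)))"
    proof -
      have e1: "(fact (2 * (j + Suc n)) :: real)
          = 2 * (real (j + n) + 1) * (2 * real (j + n) + 1) * fact (2 * (j + n))"
        by (simp add: algebra_simps)
      have e2: "(fact (j + Suc n) :: real) = (real (j + n) + 1) * fact (j + n)"
        and e3: "(fact (Suc n) :: real) = real (Suc n) * fact n" by (simp_all add: algebra_simps)
      have e4: "real (j + n) + 1 \<noteq> 0" and e5: "real (Suc n) \<noteq> 0" by linarith+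
      have "2 * y * (A / (B * C)) = S * (2 * x * y * A / ((x * B) * (S * C)))"
        if "x \<noteq> 0" "S \<noteq> 0" for x y A B C S :: real
        using that by simp
      from this[OF e4 e5] show ?thesis unfolding e1 e2 e3 .
    qed
    finally show ?case by (simp only: mult_cancel_left of_nat_eq_0_iff) simp
  qed
  also have "\<dots> = real ((2 * (j + n)) choose (j + n)) * fact j * real ((j + n) choose j)"
    by (simp add: binomial_fact field_simps mult_2)
  finally show ?thesis .
qed

lemma higher_deriv_Wfun:
  "(deriv ^^ j) (Wfun g p) = (\<lambda>r. \<Sum>k=1..p. real ((2 * k) choose k) * real k * g (2 * k)
     * (fact j * real (k choose j) * r ^ (k - j)))"
proof (induction j)
  case 0
  then show ?case by (simp add: Wfun_def fun_eq_iff)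
next
  case (Suc j)
  have c: "real (k - j) * (fact j * real (k choose j)) = fact (Suc j) * real (k choose Suc j)" for k
  proof -
    have "real (Suc j * (k choose Suc j)) = real ((k - j) * (k choose j))"
      by (simp only: binomial_absorb_comp binomial_absorption)
    then have "real (Suc j) * real (k choose Suc j) = real (k - j) * real (k choose j)"
      by (simp only: of_nat_mult)
    then show ?thesis by (simp add: mult_ac)
  qed
  have "deriv (\<lambda>r. \<Sum>k=1..p. real ((2 * k) choose k) * real k * g (2 * k)
     * (fact j * real (k choose j) * r ^ (k - j))) r
     = (\<Sum>k=1..p. real ((2 * k) choose k) * real k * g (2 * k)
     * (fact j * real (k choose j) * (real (k - j) * r ^ (k - j - 1))))" for r
    by (rule DERIV_imp_deriv) (auto intro!: derivative_eq_intros sum.cong)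
  then show ?case
    by (auto simp: Suc fun_eq_iff c[symmetric] mult_ac intro!: sum.cong simp del: fact_Suc)
qed

lemma csqrt_quotient_expansion:
  fixes l :: complex and rc :: real
  assumes rc: "rc > 0" and l: "cmod l > 4 * rc"
  shows "csqrt (l / (l - of_real (4 * rc))) * (1 / (l - of_real (4 * rc))) ^ j
    = (1 + of_real (- 4 * rc) / l) powr (- 1 / 2 - of_nat j) / l ^ j"
proof -
  have l0: "l \<noteq> 0" and ne: "l - of_real (4 * rc) \<noteq> 0" using assms by auto
  define w where "w = 1 + of_real (- 4 * rc) / l"
  have "4 * rc / cmod l < 1" using assms by (simp add: divide_less_eq)
  then have "cmod (w - 1) < 1" using rc by (simp add: w_def norm_divide norm_mult)
  then have Re: "Re w > 0" using abs_Re_le_cmod[of "w - 1"] by simp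
  then have w0: "w \<noteq> 0" by auto
  have lw: "l - of_real (4 * rc) = l * w" using l0 by (simp add: w_def field_simps)
  have "csqrt (1 / w) = w powr (- 1 / 2)"
  proof (rule csqrt_unique)
    show "(w powr (- 1 / 2))\<^sup>2 = 1 / w"
      using w0 by (simp add: power2_eq_square powr_add[symmetric] powr_minus field_simps)
    \<comment> \<open>Since w lies in the right half plane, halving its argument keeps w^(-1/2)
      there, so the principal branches agree.\<close>
    have "\<bar>Im (Ln w)\<bar> < pi / 2" using Re_Ln_pos_lt_imp[OF Re] Re w0 by (auto simp: Re_Ln_pos_lt)
    then have "cos (Im (Ln w) / 2) > 0" by (intro cos_gt_zero_pi) auto
    then show "0 < Re (w powr (- 1 / 2)) \<or> Re (w powr (- 1 / 2)) = 0 \<and> 0 \<le> Im (w powr (- 1 / 2))"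
      using w0 by (simp add: powr_def Re_exp)
  qed
  moreover have "l / (l - of_real (4 * rc)) = 1 / w" using l0 unfolding lw by simp
  moreover have "w powr (- 1 / 2 - of_nat j) = w powr (- 1 / 2) / w ^ j"
    using w0 by (simp add: powr_diff powr_nat')
  ultimately show ?thesis
    unfolding w_def[symmetric] lw by (simp add: power_divide power_mult_distrib field_simps)
qed

text \<open>The integrand is expanded in its binomial series at infinity, which converges uniformly
  on the circle. Termwise integration keeps only the power -1 of \<lambda>, that is the index n = k
  - j.\<close>

lemma contour_integral_singular_part:
  fixes rc R :: real
  assumes rc: "rc > 0" and R: "R > 4 * rc" and k: "k \<ge> 1"
  shows "((\<lambda>l. l ^ (k - 1) * (csqrt (l / (l - of_real (4 * rc))) * (1 / (l - of_real (4 * rc))) ^ j))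
    has_contour_integral (2 * pi * \<i> * of_real (real ((2 * k) choose k)
      * (fact j * real (k choose j) * rc ^ (k - j)) / (2 ^ j * real (dfact (2 * j - 1)))))) (circlepath 0 R)"
    (is "(?F has_contour_integral ?I) _")
proof -
  define a where "a = (- 1 / 2 - of_nat j :: complex)"
  define e where "e = complex_of_real (- 4 * rc)"
  have ne: "cmod e = 4 * rc" using rc unfolding e_def norm_of_real by simp
  define c where "c n = (a gchoose n) * e ^ n" for n
  define f where "f n l = c n * (l ^ k / l ^ Suc (j + n))" for n l
  have R0: "R > 0" using rc R by simp
  have F: "(\<lambda>n. f n l) sums ?F l" if l: "cmod l = R" for l
  proof -
    have l0: "l \<noteq> 0" using l R0 by auto
    have "cmod (e / l) < 1" using l R R0 by (simp add: norm_divide ne)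
    from gen_binomial_complex[OF this, of a]
    have "(\<lambda>n. l ^ (k - 1) / l ^ j * ((a gchoose n) * (e / l) ^ n))
        sums (l ^ (k - 1) / l ^ j * (1 + e / l) powr a)"
      by (rule sums_mult)
    moreover have "l ^ (k - 1) / l ^ j * ((a gchoose n) * (e / l) ^ n) = f n l" for n
    proof -
      have "l ^ k = l * l ^ (k - 1)" using k by (metis power_minus_mult mult.commute less_le_trans zero_less_one)
      then show ?thesis using l0 by (simp add: f_def c_def power_add power_divide)
    qed
    moreover have "?F l = l ^ (k - 1) / l ^ j * (1 + e / l) powr a"
      using csqrt_quotient_expansion[OF rc, of l j] l R by (simp add: a_def e_def)
    ultimately show ?thesis by simp
  qed
  have "uniform_limit (sphere 0 R) (\<lambda>n l. \<Sum>i<n. f i l) (\<lambda>l. suminf (\<lambda>i. f i l)) sequentially"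
  proof (rule Weierstrass_m_test)
    define M where "M n = cmod ((a gchoose n) * of_real (4 * rc / R) ^ n) * (R ^ k / R ^ Suc j)" for n
    show "norm (f n l) \<le> M n" if "l \<in> sphere 0 R" for n l
      using that R0 rc
      by (simp add: f_def c_def M_def norm_mult norm_divide norm_power ne power_add power_divide mult_ac)
    define y where "y = 4 * rc / R"
    \<comment> \<open>A point between y and 1: convergence of the series at x gives absolute
      convergence at the smaller y.\<close>
    define x where "x = (y + 1) / 2"
    have q: "0 < y" "y < 1" using rc R R0 by (auto simp: y_def)
    have "cmod (of_real x) < 1" using q by (simp add: x_def del: of_real_divide of_real_add)
    from sums_summable[OF gen_binomial_complex[OF this, of a]]
    have "summable (\<lambda>n. (a gchoose n) * of_real x ^ n)" .
    moreover have "cmod (of_real y) < cmod (of_real x)"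
      using q by (simp add: x_def del: of_real_divide of_real_add)
    ultimately have "summable (\<lambda>n. cmod ((a gchoose n) * of_real y ^ n))"
      by (rule powser_insidea)
    then show "summable M" unfolding M_def y_def by (rule summable_mult2)
  qed
  moreover have "suminf (\<lambda>i. f i l) = ?F l" if "l \<in> sphere 0 R" for l
    using F[of l] that by (simp add: sums_iff)
  ultimately have U: "uniform_limit (sphere 0 R) (\<lambda>n l. \<Sum>i<n. f i l) ?F sequentially"
    by (subst (asm) uniform_limit_cong'[where g = "\<lambda>n l. \<Sum>i<n. f i l" and i = ?F]) auto
  have fi: "(f n has_contour_integral c n * (if k = j + n then 2 * pi * \<i> else 0)) (circlepath 0 R)" for n
    unfolding f_def by (intro has_contour_integral_lmul contour_integral_power_quotient R0)
  have S: "((\<lambda>l. \<Sum>i<N. f i l) has_contour_integral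
      (\<Sum>i<N. c i * (if k = j + i then 2 * pi * \<i> else 0))) (circlepath 0 R)" for N
    by (intro has_contour_integral_sum fi) auto
  have "\<forall>\<^sub>F n in sequentially. (\<lambda>l. \<Sum>i<n. f i l) contour_integrable_on circlepath 0 R"
    using S by (auto simp: contour_integrable_on_def intro!: always_eventually)
  from contour_integral_uniform_limit_circlepath[OF this U _ R0]
  have int: "?F contour_integrable_on circlepath 0 R"
    and lim: "(\<lambda>n. contour_integral (circlepath 0 R) (\<lambda>l. \<Sum>i<n. f i l))
      \<longlonglongrightarrow> contour_integral (circlepath 0 R) ?F" by simp_all
  have "\<forall>\<^sub>F n in sequentially. contour_integral (circlepath 0 R) (\<lambda>l. \<Sum>i<n. f i l) = ?I"
  \<comment> \<open>From k + 1 terms on, the index k - j is included and the integrals of the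
    partial sums no longer change.\<close>
  proof (rule eventually_sequentiallyI[of "Suc k"])
    fix N assume N: "Suc k \<le> N"
    have "contour_integral (circlepath 0 R) (\<lambda>l. \<Sum>i<N. f i l)
        = (\<Sum>i<N. c i * (if k = j + i then 2 * pi * \<i> else 0))"
      by (rule contour_integral_unique[OF S])
    also have "\<dots> = ?I"
    proof (cases "j \<le> k")
      case False
      then show ?thesis by (auto intro!: sum.neutral simp: binomial_eq_0)
    next
      case True
      then obtain n where n: "k = j + n" using le_Suc_ex by blast
      have "(\<Sum>i<N. c i * (if k = j + i then 2 * pi * \<i> else 0))
          = (\<Sum>i<N. if n = i then c i * (2 * pi * \<i>) else 0)"
        by (intro sum.cong) (auto simp: n)
      also have "\<dots> = c n * (2 * pi * \<i>)" using N n by simp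
      also have "c n = of_real (((- 1 / 2 - real j) gchoose n) * (- 4) ^ n * rc ^ n)"
        
      proof -
        have "a = of_real (- 1 / 2 - real j)" by (simp add: a_def)
        moreover have "e ^ n = of_real ((- 4) ^ n * rc ^ n)"
          by (simp only: e_def of_real_power[symmetric] power_mult_distrib)
        moreover have "(of_real b gchoose n :: complex) = of_real (b gchoose n)" for b :: real
          by (simp add: gbinomial_prod_rev)
        ultimately show ?thesis
          unfolding c_def by (simp only: of_real_mult mult.assoc)
      qed
      also have "((- 1 / 2 - real j) gchoose n) * (- 4) ^ n * rc ^ n
          = real ((2 * k) choose k) * (fact j * real (k choose j) * rc ^ (k - j)) / (2 ^ j * real (dfact (2 * j - 1)))"
        using gbinomial_half_identity[of j n] dfact_pos[of "2 * j - 1"]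
        by (simp add: n field_simps)
      finally show ?thesis by (simp add: mult.commute)
    qed
    finally show "contour_integral (circlepath 0 R) (\<lambda>l. \<Sum>i<N. f i l) = ?I" .
  qed
  then have "(\<lambda>n. contour_integral (circlepath 0 R) (\<lambda>l. \<Sum>i<n. f i l)) \<longlonglongrightarrow> ?I"
    by (rule tendsto_eventually)
  with lim have eq: "contour_integral (circlepath 0 R) ?F = ?I"
    by (rule LIMSEQ_unique)
  from has_contour_integral_integral[OF int] show ?thesis unfolding eq .
qed

lemma contour_integral_Vlam:
  fixes rc R :: real
  assumes rc: "rc > 0" and R: "R > 4 * rc"
  shows "((\<lambda>l. Vlam g p l * (csqrt (l / (l - of_real (4 * rc))) * (1 / (l - of_real (4 * rc))) ^ j))
    has_contour_integral (2 * pi * \<i> * of_real ((deriv ^^ j) (Wfun g p) rc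
       / (2 ^ j * real (dfact (2 * j - 1)))))) (circlepath 0 R)"
proof -
  let ?s = "\<lambda>l. csqrt (l / (l - of_real (4 * rc))) * (1 / (l - of_real (4 * rc))) ^ j"
  let ?I = "\<lambda>k. 2 * pi * \<i> * of_real (real ((2 * k) choose k)
      * (fact j * real (k choose j) * rc ^ (k - j)) / (2 ^ j * real (dfact (2 * j - 1))))"
  have "((\<lambda>l. \<Sum>k=1..p. (of_nat k * of_real (g (2 * k))) * (l ^ (k - 1) * ?s l)) has_contour_integral
      (\<Sum>k=1..p. (of_nat k * of_real (g (2 * k))) * ?I k)) (circlepath 0 R)"
    by (intro has_contour_integral_sum has_contour_integral_lmul contour_integral_singular_part assms) auto
  moreover have "(\<lambda>l. \<Sum>k=1..p. (of_nat k * of_real (g (2 * k))) * (l ^ (k - 1) * ?s l))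
      = (\<lambda>l. Vlam g p l * ?s l)"
    by (simp add: Vlam_def sum_distrib_right mult.assoc)
  moreover have "(\<Sum>k=1..p. (of_nat k * of_real (g (2 * k))) * ?I k) = 2 * pi * \<i> * of_real
     ((deriv ^^ j) (Wfun g p) rc / (2 ^ j * real (dfact (2 * j - 1))))"
    unfolding higher_deriv_Wfun sum_divide_distrib of_real_sum sum_distrib_left
    by (intro sum.cong refl) simp
  ultimately show ?thesis by simp
qed

section \<open>The Painleve I hierarchy\<close>

lemma (in diff_ring) funpow_D_const_mult:
  assumes "D a = 0"
  shows "(D ^^ n) (a * b) = a * (D ^^ n) b"
  by (induction n) (simp_all add: D_mult assms)

lemma (in diff_ring) shift_const_mult:
  assumes "D a = 0"
  shows "shift c (fps_const a * F) = fps_const a * shift c F"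
  by (intro fps_ext)
     (simp add: shift_def Op_nth funpow_D_const_mult[OF assms] sum_distrib_left mult.left_commute)

lemma has_jet_cprod:
  assumes "\<And>i. has_jet I (\<lambda>x. f i x) (F i)" "\<And>i. has_jet I (\<lambda>x. g i x) (G i)"
  shows "has_jet I (\<lambda>x. cprod (\<lambda>i. f i x) (\<lambda>i. g i x) N)
    (\<lambda>x. (Abs_fps (\<lambda>i. F i x) * Abs_fps (\<lambda>i. G i x)) $ N)"
  unfolding cprod_def fps_mult_nth fps_nth_Abs_fps atMost_atLeast0
  by (intro has_jet_sum has_jet_mult assms)

lemma fps_const_nth_0_poly:
  "poly p (fps_const z) $ 0 = (\<Sum>i\<le>degree p. coeff p i $ 0 * z ^ i)"
  for z :: complex
  by (simp add: poly_altdef fps_sum_nth fps_power_zeroth)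

lemma fps_nth_0_prod: "prod f S $ 0 = (\<Prod>i\<in>S. f i $ 0)"
  for f :: "'a \<Rightarrow> 'b::comm_ring_1 fps"
  by (induction S rule: infinite_finite_induct) auto

interpretation jets: diff_ring fps_deriv "\<lambda>c. fps_const (complex_of_real c)"
  by (rule diff_ring_jets)

lemma has_jet_shift_coeff:
  assumes "\<And>N. has_jet I (F N) (G N)" "open I"
  shows "has_jet I (shift_coeff c F N) (\<lambda>x. jets.shift c (Abs_fps (\<lambda>N. G N x)) $ N)"
  unfolding shift_coeff_def jets.shift_def jets.Op_nth fps_nth_Abs_fps
  by (intro has_jet_sum has_jet_mult has_jet_const has_jet_deriv assms)

text \<open>The constant term of a jet is the value at the base point, so this returns from jets to
  actual derivatives of u.\<close>

lemma jets_dev_nth_0: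
  assumes "\<And>n. G $ n = of_real (nderiv n f x / fact n)"
  shows "jets.dev G P $ 0 = of_real (deval P (\<lambda>i. nderiv i f x))"
proof -
  have "(fps_deriv ^^ i) G $ 0 = of_real (nderiv i f x)" for i
    by (simp add: fps_0th_higher_deriv assms)
  then show ?thesis
    unfolding jets.dev_def jets.mon_def deval_def
    by (simp add: fps_sum_nth fps_nth_0_prod fps_power_zeroth)
qed

definition r_jet :: "real \<Rightarrow> (nat \<Rightarrow> real \<Rightarrow> real) \<Rightarrow> nat \<Rightarrow> real \<Rightarrow> complex fps" where
  "r_jet rc rk N x = (if N = 0 then fps_const (of_real rc) else if even N
     then Abs_fps (\<lambda>n. of_real (nderiv n (rk (N div 2)) x / fact n)) else 0)"

definition U_jet :: "(nat \<Rightarrow> complex \<Rightarrow> real \<Rightarrow> complex) \<Rightarrow> complex \<Rightarrow> nat \<Rightarrow> real \<Rightarrow> complex fps" where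
  "U_jet U l N x = (if even N then jet (U (N div 2) l) x else 0)"

section \<open>The string equation at a fixed \<lambda> as an identity of jets\<close>

context
  fixes I :: "real set" and rc :: real and rk :: "nat \<Rightarrow> real \<Rightarrow> real"
    and U :: "nat \<Rightarrow> complex \<Rightarrow> real \<Rightarrow> complex" and l :: complex
  assumes I: "open I" and rc: "rc > 0" and l: "cmod l > 4 * rc"
    and rk: "\<forall>k\<ge>1. smooth_on I (rk k)"
    and U: "\<And>k. smooth_on I (U k l)"
    and U0: "\<And>x. x \<in> I \<Longrightarrow> U 0 l x = csqrt (l / (l - of_real (4 * rc)))"
    and eq: "\<And>N x. x \<in> I \<Longrightarrow>
       cprod (\<lambda>a. complex_of_real (r_coeff rc rk a x))
             (cprod (\<lambda>b. U_coeff U b l x + shift_coeff (-1) (\<lambda>k y. U_coeff U k l y) b x)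
                    (\<lambda>b. U_coeff U b l x + shift_coeff 1 (\<lambda>k y. U_coeff U k l y) b x)) N
       = l * (cprod (\<lambda>a. U_coeff U a l x) (\<lambda>a. U_coeff U a l x) N - (if N = 0 then 1 else 0))"
begin

lemma has_jet_r_coeff: "has_jet I (\<lambda>x. complex_of_real (r_coeff rc rk N x)) (r_jet rc rk N)"
proof -
  consider "N = 0" | "N \<noteq> 0" "even N" | "odd N" by auto
  then show ?thesis
  proof cases
    case 2
    then have "1 \<le> N div 2" by auto
    with rk have "has_jet I (\<lambda>x. of_real (rk (N div 2) x))
        (\<lambda>x. Abs_fps (\<lambda>n. of_real (nderiv n (rk (N div 2)) x / fact n)))"
      by (intro has_jet_of_real) blast
    then show ?thesis using 2 by (simp add: r_jet_def[abs_def] r_coeff_def)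
  next
    case 3
    then have "N \<noteq> 0" by (intro notI) simp
    with 3 show ?thesis using has_jet_const[of I 0] by (simp add: r_jet_def[abs_def] r_coeff_def)
  qed (simp add: r_jet_def[abs_def] r_coeff_def has_jet_const)
qed

lemma has_jet_U_coeff: "has_jet I (\<lambda>x. U_coeff U N l x) (U_jet U l N)"
proof (cases "even N")
  case True
  then show ?thesis
    using has_jet_jet[OF U, of "N div 2"] by (simp add: U_jet_def[abs_def] U_coeff_def)
next
  case False
  then show ?thesis
    using has_jet_const[of I 0] by (simp add: U_jet_def[abs_def] U_coeff_def)
qed

text \<open>The equation holds at every point of I, so both sides have the same jet; this supplies
  all its x-derivatives at once.\<close>

lemma string_equation_jets:
  fixes x :: real
  defines "V \<equiv> Abs_fps (\<lambda>N. U_jet U l N x)"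
  assumes x: "x \<in> I"
  shows "Abs_fps (\<lambda>N. r_jet rc rk N x) * ((V + jets.shift (-1) V) * (V + jets.shift 1 V))
    = fps_const (fps_const l) * (V\<^sup>2 - 1)"
proof (rule fps_ext)
  fix N
  define Vf where "Vf y = Abs_fps (\<lambda>N. U_jet U l N y)" for y
  have sh: "has_jet I (\<lambda>x. U_coeff U b l x + shift_coeff c (\<lambda>k y. U_coeff U k l y) b x)
      (\<lambda>x. U_jet U l b x + jets.shift c (Vf x) $ b)" for b c
    unfolding Vf_def by (intro has_jet_add has_jet_U_coeff has_jet_shift_coeff I)
  have L: "has_jet I (\<lambda>x. cprod (\<lambda>a. complex_of_real (r_coeff rc rk a x))
        (cprod (\<lambda>b. U_coeff U b l x + shift_coeff (-1) (\<lambda>k y. U_coeff U k l y) b x)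
               (\<lambda>b. U_coeff U b l x + shift_coeff 1 (\<lambda>k y. U_coeff U k l y) b x)) N)
      (\<lambda>x. (Abs_fps (\<lambda>N. r_jet rc rk N x) * Abs_fps (\<lambda>i. (Abs_fps (\<lambda>b. U_jet U l b x + jets.shift (-1) (Vf x) $ b)
          * Abs_fps (\<lambda>b. U_jet U l b x + jets.shift 1 (Vf x) $ b)) $ i)) $ N)"
    by (intro has_jet_cprod has_jet_r_coeff sh)
  have "has_jet I (\<lambda>x. l * (cprod (\<lambda>a. U_coeff U a l x) (\<lambda>a. U_coeff U a l x) N - (if N = 0 then 1 else 0)))
      (\<lambda>x. fps_const l * ((Vf x * Vf x) $ N - fps_const (if N = 0 then 1 else 0)))"
    unfolding Vf_def
    by (intro has_jet_mult has_jet_diff has_jet_const has_jet_cprod has_jet_U_coeff)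
  from has_jet_unique[OF has_jet_cong[OF L eq] this I x]
  have e: "(Abs_fps (\<lambda>N. r_jet rc rk N x) * Abs_fps (\<lambda>i. (Abs_fps (\<lambda>b. U_jet U l b x + jets.shift (-1) (Vf x) $ b)
          * Abs_fps (\<lambda>b. U_jet U l b x + jets.shift 1 (Vf x) $ b)) $ i)) $ N
      = fps_const l * ((Vf x * Vf x) $ N - fps_const (if N = 0 then 1 else 0))" .
  have V: "Vf x = V" by (simp add: Vf_def V_def)
  have "Abs_fps (\<lambda>b. U_jet U l b x + jets.shift c (Vf x) $ b) = V + jets.shift c V" for c
    by (intro fps_ext) (simp add: V V_def)
  with e show "(Abs_fps (\<lambda>N. r_jet rc rk N x) * ((V + jets.shift (-1) V) * (V + jets.shift 1 V))) $ N
      = (fps_const (fps_const l) * (V\<^sup>2 - 1)) $ N"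
    by (simp add: V power2_eq_square fps_nth_inverse)
qed

text \<open>Dividing U by its leading term \<phi> makes the constant term 1. As \<phi> does not
  depend on x it commutes with the shifts, and \<phi>^2 = \<lambda> s lets \<lambda> be
  cancelled.\<close>

lemma string_equation_normalized:
  fixes x :: real
  defines "F \<equiv> fps_const (fps_const (1 / csqrt (l / (l - of_real (4 * rc))))) * Abs_fps (\<lambda>N. U_jet U l N x)"
  assumes x: "x \<in> I"
  shows "F $ 0 = 1"
    and "F\<^sup>2 = 1 + fps_X * jets.string_op rc (Abs_fps (\<lambda>n. r_jet rc rk (n + 2) x)) (fps_const (1 / (l - of_real (4 * rc)))) F"
proof -
  define \<phi> where "\<phi> = csqrt (l / (l - of_real (4 * rc)))"
  define s where "s = 1 / (l - of_real (4 * rc))"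
  define C :: "complex \<Rightarrow> complex fps fps" where "C z = fps_const (fps_const z)" for z
  define V where "V = Abs_fps (\<lambda>N. U_jet U l N x)"
  have C_mult: "C z * C w = C (z * w)" for z w by (simp add: C_def)
  have l0: "l \<noteq> 0" and ne: "l - of_real (4 * rc) \<noteq> 0" using l rc by auto
  have \<phi>2: "\<phi> * \<phi> = l * s"
    unfolding \<phi>_def s_def by (simp flip: power2_eq_square)
  have \<phi>0: "\<phi> \<noteq> 0" unfolding \<phi>_def using l0 ne by simp
  have F: "F = C (1 / \<phi>) * V" by (simp add: F_def C_def \<phi>_def V_def)
  have V: "V = C \<phi> * F" using \<phi>0 unfolding F mult.assoc[symmetric] C_mult by (simp add: C_def)
  have "U_jet U l 0 x = fps_const \<phi>"
  proof (rule has_jet_unique[OF has_jet_U_coeff _ I x])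
    show "has_jet I (\<lambda>x. U_coeff U 0 l x) (\<lambda>_. fps_const \<phi>)"
      by (rule has_jet_cong[OF has_jet_const]) (simp add: U_coeff_def U0 \<phi>_def)
  qed
  then show "F $ 0 = 1" using \<phi>0 by (simp add: F C_def V_def)
  define Rr where "Rr = Abs_fps (\<lambda>N. r_jet rc rk N x)"
  define B where "B = (F + jets.shift (-1) F) * (F + jets.shift 1 F)"
  have Rr: "Rr = fps_const (fps_const (of_real rc)) + fps_X\<^sup>2 * Abs_fps (\<lambda>n. r_jet rc rk (n + 2) x)"
  proof (rule fps_ext)
    fix N :: nat
    have "r_jet rc rk 0 x = fps_const (of_real rc)" "r_jet rc rk 1 x = 0"
      by (simp_all add: r_jet_def)
    moreover have "N = 0 \<or> N = 1 \<or> \<not> N < 2 \<and> N - 2 + 2 = N" by linarith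
    ultimately show "Rr $ N = (fps_const (fps_const (of_real rc)) + fps_X\<^sup>2 * Abs_fps (\<lambda>n. r_jet rc rk (n + 2) x)) $ N"
      unfolding Rr_def fps_add_nth fps_nth_fps_const fps_X_power_mult_nth fps_nth_Abs_fps
      by (elim disjE) (simp_all only: if_True if_False, auto)
  qed
  have sh: "jets.shift c V = C \<phi> * jets.shift c F" for c
    unfolding V C_def by (rule jets.shift_const_mult) simp
  have CC: "C \<phi> * C \<phi> = C l * C s" by (simp add: C_mult \<phi>2)
  have "(V + jets.shift (-1) V) * (V + jets.shift 1 V) = C \<phi> * C \<phi> * B"
    unfolding sh B_def by (subst (1 2) V) (simp only: algebra_simps)
  moreover have "V\<^sup>2 = C \<phi> * C \<phi> * F\<^sup>2"
    by (subst V) (simp only: power2_eq_square mult_ac)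
  ultimately have "Rr * (C l * C s * B) = C l * (C l * C s * F\<^sup>2 - 1)"
    using string_equation_jets[OF x] unfolding Rr_def V_def C_def[symmetric] CC by simp
  then have "C l * (C s * (Rr * B)) = C l * (C (l * s) * F\<^sup>2 - 1)"
    by (simp only: mult_ac C_mult)
  moreover have "C l \<noteq> 0" using l0 by (simp add: C_def)
  ultimately have "C s * (Rr * B) = C (l * s) * F\<^sup>2 - 1" by simp
  \<comment> \<open>This is \<lambda> / (\<lambda> - 4 r_c) = 1 + 4 r_c / (\<lambda> - 4 r_c), the
    form expected by \<open>string_eq_iff\<close>.\<close>
  moreover have "C (l * s) = 1 + 4 * fps_const (fps_const (of_real rc)) * C s"
  proof -
    have "l * s = 1 + 4 * of_real rc * s" using ne by (simp add: s_def field_simps)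
    then show ?thesis by (simp add: C_def numeral_fps_const flip: fps_const_1_eq_1 fps_const_add)
  qed
  ultimately show "F\<^sup>2 = 1 + fps_X * jets.string_op rc (Abs_fps (\<lambda>n. r_jet rc rk (n + 2) x)) (fps_const (1 / (l - of_real (4 * rc)))) F"
    unfolding Rr B_def C_def s_def by (simp only: jets.string_eq_iff)
qed

end

theorem theorem2:
  fixes p m :: nat and g :: "nat \<Rightarrow> real" and rc Tc cm R :: real and I :: "real set"
    and rk :: "nat \<Rightarrow> real \<Rightarrow> real"
    and U :: "nat \<Rightarrow> complex \<Rightarrow> real \<Rightarrow> complex"
  assumes hp: "p \<ge> 1" and hg: "g (2*p) > 0"
    and hm: "m \<ge> 2" and hrc: "rc > 0"
    and hWcrit: "\<forall>n\<in>{1..m-1}. (deriv ^^ n) (Wfun g p) rc = 0"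
    and hWm: "(deriv ^^ m) (Wfun g p) rc \<noteq> 0"
    and hTc: "Tc = Wfun g p rc"
    and hcm: "cm = (deriv ^^ m) (Wfun g p) rc / (2 ^ m * real (dfact (2*m - 1)))"
    and hI: "open I" "is_interval I" "I \<noteq> {}"
    and hrk: "\<forall>k\<ge>1. smooth_on I (rk k)"
    and hUan: "\<forall>k. \<forall>x\<in>I. (\<lambda>l. U k l x) holomorphic_on {l. cmod l > 4 * rc}"
    and hUsm: "\<forall>k. \<forall>l. cmod l > 4 * rc \<longrightarrow> smooth_on I (U k l)"
    and hU0: "\<forall>l x. cmod l > 4 * rc \<longrightarrow> x \<in> I \<longrightarrow>
                U 0 l x = csqrt (l / (l - of_real (4 * rc)))"
    and heq: "\<forall>N l x. cmod l > 4 * rc \<longrightarrow> x \<in> I \<longrightarrow>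
       cprod (\<lambda>a. complex_of_real (r_coeff rc rk a x))
             (cprod (\<lambda>b. U_coeff U b l x + shift_coeff (-1) (\<lambda>k y. U_coeff U k l y) b x)
                    (\<lambda>b. U_coeff U b l x + shift_coeff 1 (\<lambda>k y. U_coeff U k l y) b x)) N
       = l * (cprod (\<lambda>a. U_coeff U a l x) (\<lambda>a. U_coeff U a l x) N - (if N = 0 then 1 else 0))"
    and hR: "R > 4 * rc"
    and hint: "\<forall>N. \<forall>x\<in>I.
       contour_integral (circlepath 0 R) (\<lambda>l. Vlam g p l * U_coeff U N l x) / (2 * pi * \<i>)
       = complex_of_real ((if N = 0 then Tc else 0) + (if N = 2*m then x else 0))"
  shows "\<forall>x\<in>I. cm * deval (Rpoly rc m) (\<lambda>i. nderiv i (rk 1) x) = x"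
proof
  fix x assume x: "x \<in> I"
  define \<rho> where "\<rho> = Abs_fps (\<lambda>n. r_jet rc rk (n + 2) x)"
  obtain Q where Q_wb: "\<And>N j. N < 2 * j \<Longrightarrow> coeff (Q $ N) j = 0"
    and Q_0: "\<And>N. N > 0 \<Longrightarrow> coeff (Q $ N) 0 = 0"
    and Q_top: "\<And>k. coeff (Q $ (2 * k)) k = jets.dev (\<rho> $ 0) (Rpoly rc k)"
    and Q_eval: "\<And>s F N. fps_deriv s = 0 \<Longrightarrow> F $ 0 = 1 \<Longrightarrow>
       F\<^sup>2 = 1 + fps_X * jets.string_op rc \<rho> s F \<Longrightarrow> F $ N = poly (Q $ N) s"
    using jets.string_solution[of \<rho> rc] by blast
  define b where "b j = coeff (Q $ (2 * m)) j $ 0" for j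
  define S where "S j l = csqrt (l / (l - of_real (4 * rc))) * (1 / (l - of_real (4 * rc))) ^ j"
    for j and l :: complex
  \<comment> \<open>The coefficients \<open>b j\<close> come from \<open>Q\<close>, which depends on
    x alone, so the whole \<lambda>-dependence sits in the functions \<open>S j\<close>.\<close>
  have Um: "U m l x = (\<Sum>j\<le>m. b j * S j l)" if l: "cmod l > 4 * rc" for l
  proof -
    let ?\<phi> = "csqrt (l / (l - of_real (4 * rc)))" and ?s = "1 / (l - of_real (4 * rc))"
    define F where "F = fps_const (fps_const (1 / ?\<phi>)) * Abs_fps (\<lambda>N. U_jet U l N x)"
    have U': "\<And>k. smooth_on I (U k l)" using hUsm l by blast
    have U0': "\<And>x. x \<in> I \<Longrightarrow> U 0 l x = ?\<phi>" using hU0 l by blast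
    note norm = string_equation_normalized[OF hI(1) hrc l hrk U' U0' heq[rule_format, OF l] x,
        folded \<rho>_def F_def]
    have F: "F $ (2 * m) = poly (Q $ (2 * m)) (fps_const ?s)"
      by (rule Q_eval[OF _ norm]) simp
    have "?\<phi> \<noteq> 0" using l hrc by auto
    moreover have "F $ (2 * m) $ 0 = U m l x / ?\<phi>"
      by (simp add: F_def U_jet_def jet_def)
    ultimately have "U m l x = ?\<phi> * (\<Sum>j\<le>degree (Q $ (2 * m)). b j * ?s ^ j)"
      unfolding F fps_const_nth_0_poly b_def by simp
    also have "(\<Sum>j\<le>degree (Q $ (2 * m)). b j * ?s ^ j) = (\<Sum>j\<le>m. b j * ?s ^ j)"
    proof (rule sum.mono_neutral_left)
      show "{..degree (Q $ (2 * m))} \<subseteq> {..m}"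
        using degree_le[of m "Q $ (2 * m)"] Q_wb by auto
    qed (auto simp: b_def coeff_eq_0)
    finally show ?thesis by (simp add: S_def sum_distrib_left mult_ac)
  qed
  have R0: "R > 0" using hR hrc by simp
  define w where "w j = (deriv ^^ j) (Wfun g p) rc / (2 ^ j * real (dfact (2 * j - 1)))" for j
  have "((\<lambda>l. \<Sum>j\<le>m. b j * (Vlam g p l * S j l)) has_contour_integral
      (\<Sum>j\<le>m. b j * (2 * pi * \<i> * of_real (w j)))) (circlepath 0 R)"
    unfolding S_def w_def
    by (intro has_contour_integral_sum has_contour_integral_lmul contour_integral_Vlam hrc hR) auto
  then have "contour_integral (circlepath 0 R) (\<lambda>l. \<Sum>j\<le>m. b j * (Vlam g p l * S j l))
      = (\<Sum>j\<le>m. b j * of_real (w j)) * (2 * pi * \<i>)"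
    by (simp add: contour_integral_unique sum_distrib_right sum_distrib_left mult_ac)
  moreover have "contour_integral (circlepath 0 R) (\<lambda>l. Vlam g p l * U_coeff U (2 * m) l x)
      = contour_integral (circlepath 0 R) (\<lambda>l. \<Sum>j\<le>m. b j * (Vlam g p l * S j l))"
  proof (rule contour_integral_eq)
    fix l assume "l \<in> path_image (circlepath 0 R)"
    then have "cmod l > 4 * rc" using hR R0 by simp
    then show "Vlam g p l * U_coeff U (2 * m) l x = (\<Sum>j\<le>m. b j * (Vlam g p l * S j l))"
      by (simp add: U_coeff_def Um sum_distrib_left mult_ac)
  qed
  ultimately have "(\<Sum>j\<le>m. b j * of_real (w j)) = of_real x"
    using hint[rule_format, OF x, of "2 * m"] hm by simp
  \<comment> \<open>The term j = 0 vanishes because \<open>Q\<close> has no constant term in s at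
    positive order, and 0 < j < m is removed by criticality of W.\<close>
  also have "(\<Sum>j\<le>m. b j * of_real (w j)) = (\<Sum>j\<in>{m}. b j * of_real (w j))"
  proof (rule sum.mono_neutral_right)
    show "\<forall>j\<in>{..m} - {m}. b j * of_real (w j) = 0"
    proof
      fix j assume j: "j \<in> {..m} - {m}"
      show "b j * of_real (w j) = 0"
      proof (cases "j = 0")
        case True
        then show ?thesis using Q_0[of "2 * m"] hm by (simp add: b_def)
      next
        case False
        then have "j \<in> {1..m-1}" using j by auto
        then show ?thesis using hWcrit by (simp add: w_def)
      qed
    qed
  qed auto
  also have "\<dots> = of_real (cm * deval (Rpoly rc m) (\<lambda>i. nderiv i (rk 1) x))"
  proof -
    have "\<rho> $ 0 $ n = of_real (nderiv n (rk 1) x / fact n)" for n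
      by (simp add: \<rho>_def r_jet_def)
    then have "b m = of_real (deval (Rpoly rc m) (\<lambda>i. nderiv i (rk 1) x))"
      unfolding b_def Q_top by (rule jets_dev_nth_0)
    moreover have "w m = cm" by (simp add: w_def hcm)
    ultimately show ?thesis by simp
  qed
  finally show "cm * deval (Rpoly rc m) (\<lambda>i. nderiv i (rk 1) x) = x"
    by (simp only: of_real_eq_iff)
qed

end
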